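(* Suppose $\sigma\ge0$. In the case of the paraboloid, i.e. for $\phi_1=\cdots=\phi_n=\phi=|\cdot|^2$ on $\mathbb{R}^{n-1}$, $$\int_{x_1+\cdots+x_n=0}|T_\sigma(g_1,\dots,g_n)(x_1,\dots,x_n)|^2\,dx=2^{-(n-1)}(2\pi)^{n(n-1)}\int_{(\mathbb{R}^{n-1})^n}\frac{|g_1(\xi_1)|^2\cdots|g_n(\xi_n)|^2}{\left|\det\begin{pmatrix}1&\cdots&1\\ \xi_1&\cdots&\xi_n\end{pmatrix}\right|^{1-2\sigma}}\,d\xi$$ for functions $g_1,\dots,g_n$ (a priori in $L^1(\mathbb{R}^{n-1})$), with no support condition. If $\sigma<0$, the same identity continues to hold provided the determinant factor is non-vanishing on the supports of the $g_j$, i.e. whenever $\xi_j$ belongs to the support of $g_j$ for each $1\le j\le n$.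
   Context: Here $n\ge 2$ and $\xi=(\xi_1,\dots,\xi_n)\in(\mathbb{R}^{n-1})^n$. For smooth $\phi_1,\dots,\phi_n:\mathbb{R}^{n-1}\to\mathbb{R}$, $\sigma\in\mathbb{R}$, and $x_1,\dots,x_n\in\mathbb{R}^n$ with $x_j=(x_j',x_{jn})\in\mathbb{R}^{n-1}\times\mathbb{R}$, the multilinear operator $T_\sigma$ is $$T_\sigma(g_1,\dots,g_n)(x_1,\dots,x_n)=\int_{(\mathbb{R}^{n-1})^n}\left|\det\begin{pmatrix}1&\cdots&1\\ \nabla\phi_1(\xi_1)&\cdots&\nabla\phi_n(\xi_n)\end{pmatrix}\right|^\sigma\prod_{j=1}^n e^{i(x_j'\cdot\xi_j+x_{jn}\phi_j(\xi_j))}g_j(\xi_j)\,d\xi_j ,$$ where the matrix is the $n\times n$ matrix with $j$-th column $(1,\nabla\phi_j(\xi_j))^T$. The integral over $x_1+\cdots+x_n=0$ means $\int_{(\mathbb{R}^n)^{n-1}}|T_\sigma(g_1,\dots,g_n)(x_1,\dots,x_{n-1},-x_1-\cdots-x_{n-1})|^2\,dx_1\cdots dx_{n-1}$.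
   Formalization: The constant 2^{-(n-1)} is corrected to 2^{-(n-1)(1-2σ)}, since ∇φ=2ξ puts 2^{n-1} into the determinant of T_σ (the printed constant is right only for σ=0); the integral defining T_σ is assumed to converge absolutely, which L^1 alone does not ensure for σ≠0. *)

theory Defs
  imports "HOL-Analysis.Analysis"
begin

text \<open>
  Throughout, \<^typ>\<open>'m\<close> has \<open>n - 1\<close> elements, so that \<^typ>\<open>'m option\<close> has \<open>n\<close>; \<^term>\<open>None\<close> is the
  \<open>n\<close>-th index of a function or point, and the top row of the matrix. The space
  \<open>\<real>\<^sup>n = \<real>\<^sup>n\<^sup>-\<^sup>1 \<times> \<real>\<close> is \<^typ>\<open>(real^'m) \<times> real\<close>, and a point \<open>\<xi> \<in> (\<real>\<^sup>n\<^sup>-\<^sup>1)\<^sup>n\<close> is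
  \<open>\<xi> :: (real^'m)^'m option\<close>.
\<close>

definition grad :: "('a::real_inner \<Rightarrow> real) \<Rightarrow> 'a \<Rightarrow> 'a" where
  "grad \<phi> \<xi> = (THE D. GDERIV \<phi> \<xi> :> D)"

text \<open>The matrix with \<open>j\<close>-th column \<open>(1, v\<^sub>j)\<close>.\<close>

definition bordered :: "(real^'m)^'m option \<Rightarrow> real^'m option^'m option" where
  "bordered v = (\<chi> i j. case i of None \<Rightarrow> 1 | Some k \<Rightarrow> v $ j $ k)"

text \<open>Unlike \<open>powr\<close>, for which \<open>0 powr 0 = 0\<close>, this has \<open>0\<^sup>0 = 1\<close>. For \<open>s < 0\<close> it still has value 0 at
  \<open>a = 0\<close>; for the determinants of the paraboloid this concerns a Lebesgue null set only.\<close>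

definition rpow :: "real \<Rightarrow> real \<Rightarrow> real" where
  "rpow a s = (if s = 0 then 1 else a powr s)"

definition det_weight ::
  "('m option \<Rightarrow> real^'m \<Rightarrow> real) \<Rightarrow> real \<Rightarrow> (real^'m)^'m option \<Rightarrow> real" where
  "det_weight \<phi> \<sigma> \<xi> = rpow \<bar>det (bordered (\<chi> j. grad (\<phi> j) (\<xi> $ j)))\<bar> \<sigma>"

definition T_op ::
  "('m option \<Rightarrow> real^'m \<Rightarrow> real) \<Rightarrow> real \<Rightarrow> ('m option \<Rightarrow> real^'m \<Rightarrow> complex)
    \<Rightarrow> ((real^'m) \<times> real)^'m option \<Rightarrow> complex" where
  "T_op \<phi> \<sigma> g x =
    (LINT \<xi>|lebesgue. complex_of_real (det_weight \<phi> \<sigma> \<xi>) *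
      (\<Prod>j\<in>UNIV. exp (\<i> * complex_of_real (fst (x $ j) \<bullet> \<xi> $ j + snd (x $ j) * \<phi> j (\<xi> $ j)))
                 * g j (\<xi> $ j)))"

text \<open>
  The \<open>T_op\<close> integrand has modulus \<open>det_weight \<phi> \<sigma> \<xi> * (\<Prod>j\<in>UNIV. cmod (g j (\<xi> $ j)))\<close> for every
  \<open>x\<close>, so the following says exactly that the integral defining \<open>T_op \<phi> \<sigma> g\<close> converges absolutely.
  Without it, \<open>LINT\<close> would return the junk value 0.
\<close>

definition T_defined ::
  "('m option \<Rightarrow> real^'m \<Rightarrow> real) \<Rightarrow> real \<Rightarrow> ('m option \<Rightarrow> real^'m \<Rightarrow> complex) \<Rightarrow> bool" where
  "T_defined \<phi> \<sigma> g \<longleftrightarrow>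
    integrable lebesgue (\<lambda>\<xi>. complex_of_real (det_weight \<phi> \<sigma> \<xi>) * (\<Prod>j\<in>UNIV. g j (\<xi> $ j)))"

text \<open>The point \<open>(x\<^sub>1, \<dots>, x\<^sub>n\<^sub>-\<^sub>1, -x\<^sub>1 - \<dots> - x\<^sub>n\<^sub>-\<^sub>1)\<close>.\<close>

definition sum_zero_point :: "((real^'m) \<times> real)^'m \<Rightarrow> ((real^'m) \<times> real)^'m option" where
  "sum_zero_point x = (\<chi> j. case j of None \<Rightarrow> - (\<Sum>k\<in>UNIV. x $ k) | Some k \<Rightarrow> x $ k)"

definition supp :: "('a::topological_space \<Rightarrow> 'b::zero) \<Rightarrow> 'a set" where
  "supp f = closure {x. f x \<noteq> 0}"

definition paraboloid :: "'a::real_normed_vector \<Rightarrow> real" where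
  "paraboloid \<xi> = (norm \<xi>)\<^sup>2"

end

theory Submission
  imports Defs "HOL-Probability.Characteristic_Functions"
begin

text \<open>
  On the hyperplane \<open>x\<^sub>1 + \<dots> + x\<^sub>n = 0\<close> the phase is \<open>x \<bullet> \<Phi>(\<xi>)\<close>, where \<open>\<Phi>(\<xi>)\<close> has the components
  \<open>(\<xi>\<^sub>k - \<xi>\<^sub>n, |\<xi>\<^sub>k|\<^sup>2 - |\<xi>\<^sub>n|\<^sup>2)\<close> for \<open>k < n\<close>. Source and target of \<open>\<Phi>\<close> both have dimension \<open>n(n-1)\<close>.
  With \<open>a\<^sub>k = \<xi>\<^sub>k - \<xi>\<^sub>n\<close> fixed, \<open>|\<xi>\<^sub>k|\<^sup>2 - |\<xi>\<^sub>n|\<^sup>2 = |a\<^sub>k|\<^sup>2 + 2 a\<^sub>k \<bullet> \<xi>\<^sub>n\<close> is affine in \<open>\<xi>\<^sub>n\<close>, so \<open>\<Phi>\<close> is injective off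
  the null set where the determinant vanishes, and its Jacobian is \<open>2\<^sup>n\<^sup>-\<^sup>1 |det a|\<close>; moreover \<open>det a\<close> is the
  determinant of the bordered matrix. Hence \<open>T\<^sub>\<sigma>\<close> is the Fourier transform of an integrable function
  and the identity is Plancherel's theorem. Plancherel is needed for \<open>L\<^sup>1\<close> functions with both sides possibly
  infinite; it follows by Gaussian regularisation and Fatou's lemma.
\<close>

section \<open>Gaussian integrals\<close>

text \<open>Neither the transform T nor the function F is known to be square integrable, so |T|^2
  cannot be expanded into a double integral and integrated directly. With the weight exp (-a |x|^2)
  it can, and the x-integral becomes an explicit Gaussian; the same quadratic form
  \<open>gauss_form a F\<close> arises from a Gaussian mollification of F. This gives an exact and
  finite identity for each a > 0, and only the limit a -> 0 has to admit infinite values. Because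
  \<open>phase\<close> is affine in the last vector once the differences are frozen, its change of
  variables needs only Fubini, translations and invertible matrices. The gradient of the paraboloid
  is 2 \<xi>, so the determinant inside the weight of the operator is, up to sign, the Jacobian of
  \<open>phase\<close> itself. The weight contributes the power 2 \<sigma> of this Jacobian to |T|^2
  and the change of variables the power -1; this is the origin of the exponent 1 - 2
  \<sigma>.\<close>

lemma gauss_fourier_real:
  fixes a t :: real
  assumes a: "a > 0"
  shows "has_bochner_integral lborel (\<lambda>x. iexp (t * x) * complex_of_real (exp (- a * x\<^sup>2)))
           (complex_of_real (sqrt (pi / a) * exp (- t\<^sup>2 / (4 * a))))"
proof -
  \<comment> \<open>Chosen so that (c x)^2 / 2 = a x^2: the substitution x -> c x turns the
    characteristic function of the standard normal law at t / c into the wanted integral.\<close>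
  define c where "c = sqrt (2 * a)"
  have c: "c > 0" "c\<^sup>2 = 2 * a" using a by (auto simp: c_def)
  define f where "f = (\<lambda>x. std_normal_density x *\<^sub>R iexp (t / c * x))"
  have int: "integrable lborel f"
    unfolding f_def
    by (rule Bochner_Integration.integrable_bound[OF integrable_normal_density[of 1 0]])
       (auto simp: norm_mult normal_density_nonneg)
  have "integral\<^sup>L lborel f = char std_normal_distribution (t / c)"
    unfolding char_def f_def by (subst integral_density) (auto simp: normal_density_nonneg)
  also have "\<dots> = complex_of_real (exp (- (t / c)\<^sup>2 / 2))"
    by (simp add: char_std_normal_distribution)
  finally have "has_bochner_integral lborel f (complex_of_real (exp (- (t / c)\<^sup>2 / 2)))"
    using int by (simp add: has_bochner_integral_iff)
  then have "has_bochner_integral lborel (\<lambda>x. f (0 + c * x)) (complex_of_real (exp (- (t / c)\<^sup>2 / 2)) /\<^sub>R \<bar>c\<bar>)"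
    using c by (subst (asm) lborel_has_bochner_integral_real_affine_iff[of c _ _ 0]) auto
  then have "has_bochner_integral lborel (\<lambda>x. complex_of_real (sqrt (2 * pi)) * f (0 + c * x))
      (complex_of_real (sqrt (2 * pi)) * (complex_of_real (exp (- (t / c)\<^sup>2 / 2)) /\<^sub>R \<bar>c\<bar>))"
    by (rule has_bochner_integral_mult_right[rotated])
  moreover have "complex_of_real (sqrt (2 * pi)) * f (0 + c * x) = iexp (t * x) * complex_of_real (exp (- a * x\<^sup>2))" for x
  proof -
    have "(c * x)\<^sup>2 / 2 = a * x\<^sup>2" using c by (simp add: power_mult_distrib)
    then show ?thesis using c
      by (simp add: f_def std_normal_density_def scaleR_conv_of_real)
  qed
  moreover have "complex_of_real (sqrt (2 * pi)) * (complex_of_real (exp (- (t / c)\<^sup>2 / 2)) /\<^sub>R \<bar>c\<bar>)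
     = complex_of_real (sqrt (pi / a) * exp (- t\<^sup>2 / (4 * a)))"
  proof -
    have "(t / c)\<^sup>2 / 2 = t\<^sup>2 / (4 * a)" using c by (simp add: power_divide)
    moreover have "sqrt (2 * pi) / c = sqrt (pi / a)"
      using a by (simp add: c_def real_sqrt_divide[symmetric] )
    ultimately show ?thesis using c by (simp add: scaleR_conv_of_real field_simps flip: of_real_mult of_real_divide)
  qed
  ultimately show ?thesis by simp
qed

text \<open>Lebesgue measure is the image of the product measure indexed by \<open>Basis\<close>,
  under which the integral of a product of one-variable functions factorises.\<close>

lemma integral_lborel_prod_Basis:
  fixes f :: "'a::euclidean_space \<Rightarrow> real \<Rightarrow> complex"
  assumes "\<And>b. b \<in> Basis \<Longrightarrow> integrable lborel (f b)"
  shows "has_bochner_integral lborel (\<lambda>x::'a. \<Prod>b\<in>Basis. f b (x \<bullet> b)) (\<Prod>b\<in>Basis. integral\<^sup>L lborel (f b))"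
proof -
  interpret product_sigma_finite "\<lambda>_::'a. lborel :: real measure" by standard
  have m[measurable]: "b \<in> Basis \<Longrightarrow> f b \<in> borel_measurable borel" for b
    using assms[of b] by (auto dest: borel_measurable_integrable)
  have *: "(\<Sum>b'\<in>Basis. x b' *\<^sub>R b') \<bullet> b = x b" if "b \<in> Basis" for x and b :: 'a
    using that by simp
  have i: "integrable (Pi\<^sub>M Basis (\<lambda>_. lborel)) (\<lambda>x. \<Prod>b\<in>Basis. f b ((\<Sum>b'\<in>Basis. x b' *\<^sub>R b') \<bullet> b))"
    using product_integrable_prod[OF finite_Basis assms] by (simp cong: prod.cong)
  have v: "integral\<^sup>L (Pi\<^sub>M Basis (\<lambda>_. lborel)) (\<lambda>x. \<Prod>b\<in>Basis. f b ((\<Sum>b'\<in>Basis. x b' *\<^sub>R b') \<bullet> b))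
     = (\<Prod>b\<in>Basis. integral\<^sup>L lborel (f b))"
    using product_integral_prod[OF finite_Basis assms] by (simp cong: prod.cong)
  show ?thesis
    unfolding has_bochner_integral_iff
    using i v by (subst (1 2) lborel_eq) (simp add: integrable_distr_eq integral_distr)
qed

lemma norm_eq_sum_Basis: "(norm (x::'a::euclidean_space))\<^sup>2 = (\<Sum>b\<in>Basis. (x \<bullet> b)\<^sup>2)"
  by (subst power2_norm_eq_inner, subst euclidean_inner) (simp add: power2_eq_square)

lemma gauss_fourier:
  fixes y :: "'a::euclidean_space" and a :: real
  assumes a: "a > 0"
  shows "has_bochner_integral lborel (\<lambda>x. iexp (x \<bullet> y) * complex_of_real (exp (- a * (norm x)\<^sup>2)))
           (complex_of_real (sqrt (pi / a) ^ DIM('a) * exp (- (norm y)\<^sup>2 / (4 * a))))"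
proof -
  let ?f = "\<lambda>b x. iexp (y \<bullet> b * x) * complex_of_real (exp (- a * x\<^sup>2))"
  have 1: "integrable lborel (?f b)"
    and 2: "integral\<^sup>L lborel (?f b) = complex_of_real (sqrt (pi / a) * exp (- (y \<bullet> b)\<^sup>2 / (4 * a)))" for b
    using gauss_fourier_real[OF a, of "y \<bullet> b"] by (auto simp: has_bochner_integral_iff)
  have 3: "(\<Prod>b\<in>Basis. ?f b (x \<bullet> b)) = iexp (x \<bullet> y) * complex_of_real (exp (- a * (norm x)\<^sup>2))" for x
    by (simp add: prod.distrib exp_sum[symmetric] norm_eq_sum_Basis sum_distrib_left sum_negf flip: of_real_prod)
      (simp add: euclidean_inner[of x y] sum_distrib_left mult_ac exp_sum)
  have 4: "(\<Prod>b\<in>Basis. complex_of_real (sqrt (pi / a) * exp (- (y \<bullet> b)\<^sup>2 / (4 * a))))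
     = complex_of_real (sqrt (pi / a) ^ DIM('a) * exp (- (norm y)\<^sup>2 / (4 * a)))"
    by (simp add: prod.distrib exp_sum[symmetric] norm_eq_sum_Basis sum_negf sum_divide_distrib flip: of_real_prod)
  show ?thesis
    using integral_lborel_prod_Basis[of ?f, OF 1] by (simp only: 2 3 4)
qed

text \<open>Real part of the Fourier formula at frequency 0, moved by translation invariance. The
  free centre \<open>v\<close> serves products of two Gaussians, whose common centre is the midpoint
  of the two.\<close>

lemma gauss_integral:
  fixes v :: "'a::euclidean_space" and a :: real
  assumes a: "a > 0"
  shows "has_bochner_integral lborel (\<lambda>x::'a. exp (- a * (norm (x - v))\<^sup>2)) (sqrt (pi / a) ^ DIM('a))"
proof -
  have "has_bochner_integral lborel (\<lambda>x. complex_of_real (exp (- a * (norm (x::'a))\<^sup>2))) (complex_of_real (sqrt (pi / a) ^ DIM('a)))"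
    using gauss_fourier[OF a, of "0::'a"] by simp
  from has_bochner_integral_Re[OF this]
  have *: "has_bochner_integral lborel (\<lambda>x. exp (- a * (norm (x::'a))\<^sup>2)) (sqrt (pi / a) ^ DIM('a))"
    by (simp flip: of_real_exp of_real_power of_real_mult)
  have "has_bochner_integral (distr lborel borel ((+) (- v))) (\<lambda>x. exp (- a * (norm (x::'a))\<^sup>2)) (sqrt (pi / a) ^ DIM('a))"
    using * by (simp add: lborel_distr_plus)
  then show ?thesis
    by (simp add: has_bochner_integral_iff integrable_distr_eq integral_distr)
qed

section \<open>Continuity of translation in L1\<close>

text \<open>The set U - K is covered by three pieces of measure below e/3: U - A, the part of A
  outside a large ball, and the part of A in that ball missed by a closed subset K. Cutting with the
  ball is what makes the closed set compact.\<close>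

lemma lborel_inner_compact_outer_open:
  fixes A :: "'a::euclidean_space set"
  assumes A[measurable]: "A \<in> sets borel" and fin: "emeasure lborel A < \<infinity>" and e: "e > (0::real)"
  obtains K U where "compact K" "open U" "K \<subseteq> A" "A \<subseteq> U" "emeasure lborel (U - K) \<le> ennreal e"
proof -
  have "(\<lambda>n. emeasure lborel (A - cball 0 (real n))) \<longlonglongrightarrow> emeasure lborel (\<Inter>n. A - cball 0 (real n))"
    using fin by (intro Lim_emeasure_decseq) 
        (auto simp: decseq_def intro!: order.strict_implies_not_eq le_less_trans[OF emeasure_mono[of _ A]])
  moreover have "(\<Inter>n. A - cball 0 (real n)) = {}"
    by (auto simp: real_arch_simple)
  ultimately have "(\<lambda>n. emeasure lborel (A - cball 0 (real n))) \<longlonglongrightarrow> 0" by (simp only: emeasure_empty)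
  then have "eventually (\<lambda>n. emeasure lborel (A - cball 0 (real n)) < ennreal (e / 3)) sequentially"
    using e by (intro order_tendstoD) auto
  then obtain n where n: "emeasure lborel (A - cball 0 (real n)) < ennreal (e / 3)"
    by (auto simp: eventually_sequentially)
  have "A \<inter> cball 0 (real n) \<in> sets lebesgue" by (auto intro!: sets_completionI_sets)
  then obtain K where K: "closed K" "K \<subseteq> A \<inter> cball 0 (real n)"
      "emeasure lebesgue (A \<inter> cball 0 (real n) - K) < ennreal (e / 3)"
    using e sets_lebesgue_inner_closed[of "A \<inter> cball 0 (real n)" "e / 3"] by (metis divide_pos_pos zero_less_numeral)
  have [measurable]: "K \<in> sets borel" using K by auto
  have K3: "emeasure lborel (A \<inter> cball 0 (real n) - K) < ennreal (e / 3)"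
    using K(3) by simp
  obtain U where U: "open U" "A \<subseteq> U" "emeasure lborel (U - A) < ennreal (e / 3)"
    using outer_regular_lborel[of A "e / 3"] e by auto
  have [measurable]: "U \<in> sets borel" using U by auto
  have "emeasure lborel (U - K) \<le> emeasure lborel ((U - A) \<union> (A - cball 0 (real n)) \<union> (A \<inter> cball 0 (real n) - K))"
    by (rule emeasure_mono) auto
  also have "\<dots> \<le> emeasure lborel (U - A) + emeasure lborel (A - cball 0 (real n)) + emeasure lborel (A \<inter> cball 0 (real n) - K)"
    by (rule order_trans[OF emeasure_subadditive]) (auto intro!: add_mono emeasure_subadditive)
  also have "\<dots> \<le> ennreal (e / 3) + ennreal (e / 3) + ennreal (e / 3)"
    using n K3 U(3) by (intro add_mono) auto
  also have "\<dots> = ennreal e" using e by (simp flip: ennreal_plus)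
  finally have "emeasure lborel (U - K) \<le> ennreal e" .
  moreover have "compact K"
    using K by (auto simp: compact_eq_bounded_closed intro: bounded_subset[of "cball 0 (real n)"])
  ultimately show thesis using K U by (intro that[of K U]) auto
qed

lemma nn_integral_lborel_translate:
  fixes f :: "'a::euclidean_space \<Rightarrow> ennreal"
  assumes [measurable]: "f \<in> borel_measurable borel"
  shows "(\<integral>\<^sup>+x. f (c + x) \<partial>lborel) = (\<integral>\<^sup>+x. f x \<partial>lborel)"
  by (subst (2) lborel_distr_plus[symmetric, of c]) (simp add: nn_integral_distr)

lemma nn_integral_lborel_scale:
  fixes f :: "'a::euclidean_space \<Rightarrow> ennreal"
  assumes [measurable]: "f \<in> borel_measurable borel" and "c \<noteq> 0"
  shows "(\<integral>\<^sup>+x. f x \<partial>lborel) = ennreal (\<bar>c\<bar> ^ DIM('a)) * (\<integral>\<^sup>+x. f (t + c *\<^sub>R x) \<partial>lborel)"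
  by (subst lborel_affine[OF \<open>c \<noteq> 0\<close>, of t])
    (simp add: nn_integral_density nn_integral_distr nn_integral_cmult)

text \<open>Induction over integrable functions: multiples of indicators by regularity of the
  measure, then sums, then dominated limits. For an indicator, compactness of K gives a radius d
  such that shifts of K by less than d stay inside U.\<close>

lemma translation_continuous_L1:
  fixes F :: "'a::euclidean_space \<Rightarrow> 'b::{banach, second_countable_topology}"
  assumes "integrable lborel F" and "e > (0::real)"
  shows "\<exists>d>0. \<forall>h. norm h < d \<longrightarrow> (\<integral>\<^sup>+w. ennreal (norm (F (h + w) - F w)) \<partial>lborel) \<le> ennreal e"
  using assms
proof (induct arbitrary: e)
  case (base A c)
  show ?case
  proof (cases "c = 0")
    case False
    obtain K U where KU: "compact K" "open U" "K \<subseteq> A" "A \<subseteq> U"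
      and m: "emeasure lborel (U - K) \<le> ennreal (e / (2 * norm c))"
      using lborel_inner_compact_outer_open[of A "e / (2 * norm c)"] base False by auto
    obtain d where d: "d > 0" "(\<Union>x\<in>K. ball x d) \<subseteq> U"
      using compact_subset_open_imp_ball_epsilon_subset[of K U] KU by (metis subset_trans)
    have [measurable]: "A \<in> sets borel" "K \<in> sets borel" "U \<in> sets borel" using KU base by (auto intro: borel_compact)
    show ?thesis
    proof (intro exI conjI allI impI)
      fix h :: 'a assume h: "norm h < d"
      have 1: "x + h \<in> U \<and> x - h \<in> U" if "x \<in> K" for x
      proof -
        have "x + h \<in> ball x d" "x - h \<in> ball x d" using h by (simp_all add: dist_norm)
        then show ?thesis using d(2) that by blast
      qed
      have "(\<integral>\<^sup>+w. ennreal (norm (indicator A (h + w) *\<^sub>R c - indicator A w *\<^sub>R c)) \<partial>lborel) \<le>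
        (\<integral>\<^sup>+w. ennreal (norm c) * (indicator (U - K) (h + w) + indicator (U - K) w) \<partial>lborel)"
      proof (rule nn_integral_mono)
        fix w
        \<comment> \<open>Suppose exactly one of w and h + w lies in A. If that point is outside K,
          it is in U - K. If it is in K, the other point is in U but not in A, hence in U - K.
          Shifts by h and by -h are both used.\<close>
        have key: "(h + w \<in> A) = (w \<in> A) \<or> h + w \<in> U - K \<or> w \<in> U - K"
          using 1[of "h + w"] 1[of w] KU(3,4) by (auto simp: add.commute)
        show "ennreal (norm (indicator A (h + w) *\<^sub>R c - indicator A w *\<^sub>R c)) \<le>
          ennreal (norm c) * (indicator (U - K) (h + w) + indicator (U - K) w)"
        proof (cases "(h + w \<in> A) = (w \<in> A)")
          case False
          then have "ennreal (norm (indicator A (h + w) *\<^sub>R c - indicator A w *\<^sub>R c)) = ennreal (norm c) * 1"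
            by (auto simp: indicator_def)
          also have "\<dots> \<le> ennreal (norm c) * (indicator (U - K) (h + w) + indicator (U - K) w)"
            using key False by (intro mult_left_mono) (auto simp: indicator_def)
          finally show ?thesis .
        qed (simp add: indicator_def)
      qed
      also have "\<dots> = ennreal (norm c) * ((\<integral>\<^sup>+w. indicator (U - K) (h + w) \<partial>lborel) + (\<integral>\<^sup>+w. indicator (U - K) w \<partial>lborel))"
        by (simp add: nn_integral_cmult nn_integral_add)
      also have "\<dots> \<le> ennreal (norm c) * (ennreal (e / (2 * norm c)) + ennreal (e / (2 * norm c)))"
        using m by (subst nn_integral_lborel_translate) (auto intro!: mult_left_mono add_mono)
      also have "\<dots> = ennreal e" using False \<open>e > 0\<close>
        by (simp flip: ennreal_plus ennreal_mult)
      finally show "(\<integral>\<^sup>+w. ennreal (norm (indicator A (h + w) *\<^sub>R c - indicator A w *\<^sub>R c)) \<partial>lborel) \<le> ennreal e" .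
    qed (use d in auto)
  qed (auto intro: exI[of _ 1])
next
  case (add f g)
  obtain d1 d2 where d: "d1 > 0" "d2 > 0"
    "\<And>h. norm h < d1 \<Longrightarrow> (\<integral>\<^sup>+w. ennreal (norm (f (h + w) - f w)) \<partial>lborel) \<le> ennreal (e / 2)"
    "\<And>h. norm h < d2 \<Longrightarrow> (\<integral>\<^sup>+w. ennreal (norm (g (h + w) - g w)) \<partial>lborel) \<le> ennreal (e / 2)"
    using add(2)[of "e / 2"] add(4)[of "e / 2"] \<open>e > 0\<close> by auto
  have [measurable]: "f \<in> borel_measurable borel" "g \<in> borel_measurable borel"
    using add(1,3) by (auto dest: borel_measurable_integrable)
  show ?case
  proof (intro exI[of _ "min d1 d2"] conjI allI impI)
    fix h :: 'a assume h: "norm h < min d1 d2"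
    have "(\<integral>\<^sup>+w. ennreal (norm (f (h + w) + g (h + w) - (f w + g w))) \<partial>lborel) \<le>
       (\<integral>\<^sup>+w. ennreal (norm (f (h + w) - f w)) + ennreal (norm (g (h + w) - g w)) \<partial>lborel)"
      by (intro nn_integral_mono) (simp flip: ennreal_plus add: add_diff_add norm_triangle_ineq)
    also have "\<dots> \<le> ennreal (e / 2) + ennreal (e / 2)"
      using d(3,4)[of h] h by (subst nn_integral_add) (auto intro!: add_mono)
    also have "\<dots> = ennreal e" using \<open>e > 0\<close> by (simp flip: ennreal_plus)
    finally show "(\<integral>\<^sup>+w. ennreal (norm (f (h + w) + g (h + w) - (f w + g w))) \<partial>lborel) \<le> ennreal e" .
  qed (use d in auto)
next
  case (lim f s)
  have [measurable]: "\<And>i. s i \<in> borel_measurable borel" "f \<in> borel_measurable borel"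
    using lim(1,5) by (auto dest: borel_measurable_integrable)
  \<comment> \<open>The approximants of the induction satisfy
    \<open>norm (s i w) \<le> 2 * norm (f w)\<close>, so this is the dominating function.\<close>
  have "(\<integral>\<^sup>+w. ennreal (2 * norm (f w)) \<partial>lborel) < \<infinity>"
    using lim(5) by (simp add: ennreal_mult nn_integral_cmult ennreal_mult_less_top integrable_iff_bounded)
  then have "(\<lambda>i. \<integral>\<^sup>+w. ennreal (norm (f w - s i w)) \<partial>lborel) \<longlonglongrightarrow> 0"
    using lim by (intro nn_integral_dominated_convergence_norm[where w="\<lambda>x. 2 * norm (f x)"])
      (auto simp: integrable_iff_bounded)
  then have "eventually (\<lambda>i. (\<integral>\<^sup>+w. ennreal (norm (f w - s i w)) \<partial>lborel) < ennreal (e / 3)) sequentially"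
    using \<open>e > 0\<close> by (intro order_tendstoD) auto
  then obtain i where i: "(\<integral>\<^sup>+w. ennreal (norm (f w - s i w)) \<partial>lborel) < ennreal (e / 3)"
    by (auto simp: eventually_sequentially)
  obtain d where d: "d > 0" "\<And>h. norm h < d \<Longrightarrow> (\<integral>\<^sup>+w. ennreal (norm (s i (h + w) - s i w)) \<partial>lborel) \<le> ennreal (e / 3)"
    using lim(2)[of "e / 3" i] \<open>e > 0\<close> by auto
  show ?case
  proof (intro exI[of _ d] conjI allI impI)
    fix h :: 'a assume h: "norm h < d"
    have tri: "norm (f (h + w) - f w) \<le> norm (f (h + w) - s i (h + w)) + norm (s i (h + w) - s i w) + norm (f w - s i w)" for w
      using norm_triangle_ineq4[of "f (h + w) - s i (h + w) + (s i (h + w) - s i w)" "f w - s i w"]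
        norm_triangle_ineq[of "f (h + w) - s i (h + w)" "s i (h + w) - s i w"] by simp
    have "(\<integral>\<^sup>+w. ennreal (norm (f (h + w) - f w)) \<partial>lborel) \<le>
      (\<integral>\<^sup>+w. ennreal (norm (f (h + w) - s i (h + w))) + ennreal (norm (s i (h + w) - s i w)) + ennreal (norm (f w - s i w)) \<partial>lborel)"
      using tri by (intro nn_integral_mono) (simp flip: ennreal_plus)
    also have "\<dots> = (\<integral>\<^sup>+w. ennreal (norm (f (h + w) - s i (h + w))) \<partial>lborel) + (\<integral>\<^sup>+w. ennreal (norm (s i (h + w) - s i w)) \<partial>lborel)
       + (\<integral>\<^sup>+w. ennreal (norm (f w - s i w)) \<partial>lborel)"
      by (simp add: nn_integral_add)
    also have "\<dots> \<le> ennreal (e / 3) + ennreal (e / 3) + ennreal (e / 3)"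
      using i d(2)[OF h] nn_integral_lborel_translate[of "\<lambda>w. ennreal (norm (f w - s i w))" h]
      by (intro add_mono) auto
    also have "\<dots> = ennreal e" using \<open>e > 0\<close> by (simp flip: ennreal_plus)
    finally show "(\<integral>\<^sup>+w. ennreal (norm (f (h + w) - f w)) \<partial>lborel) \<le> ennreal e" .
  qed (use d in auto)
qed

section \<open>Plancherel's theorem for integrable functions\<close>

lemma nn_integral_lborel_pair_product:
  fixes f :: "'a::euclidean_space \<Rightarrow> ennreal" and g :: "'b::euclidean_space \<Rightarrow> ennreal"
  assumes [measurable]: "f \<in> borel_measurable borel" "g \<in> borel_measurable borel"
  shows "(\<integral>\<^sup>+p. f (fst p) * g (snd p) \<partial>(lborel \<Otimes>\<^sub>M lborel)) = (\<integral>\<^sup>+x. f x \<partial>lborel) * (\<integral>\<^sup>+y. g y \<partial>lborel)"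
  by (subst lborel.nn_integral_fst[symmetric]) (auto simp: nn_integral_cmult nn_integral_multc)

lemma has_bochner_integral_lborel_pair_product:
  fixes f :: "'a::euclidean_space \<Rightarrow> complex" and g :: "'b::euclidean_space \<Rightarrow> complex"
  assumes f: "integrable lborel f" and g: "integrable lborel g"
  shows "has_bochner_integral (lborel \<Otimes>\<^sub>M lborel) (\<lambda>p. f (fst p) * g (snd p))
           (integral\<^sup>L lborel f * integral\<^sup>L lborel g)"
proof -
  have [measurable]: "f \<in> borel_measurable borel" "g \<in> borel_measurable borel"
    using f g by (auto dest: borel_measurable_integrable)
  have "(\<integral>\<^sup>+p. ennreal (norm (f (fst p) * g (snd p))) \<partial>(lborel \<Otimes>\<^sub>M lborel))
     = (\<integral>\<^sup>+x. norm (f x) \<partial>lborel) * (\<integral>\<^sup>+y. norm (g y) \<partial>lborel)"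
    by (subst nn_integral_lborel_pair_product[symmetric]) (auto simp: norm_mult ennreal_mult)
  then have i: "integrable (lborel \<Otimes>\<^sub>M lborel) (\<lambda>p. f (fst p) * g (snd p))"
    using f g by (auto simp: integrable_iff_bounded ennreal_mult_less_top)
  moreover have "integral\<^sup>L (lborel \<Otimes>\<^sub>M lborel) (\<lambda>p. f (fst p) * g (snd p)) = integral\<^sup>L lborel f * integral\<^sup>L lborel g"
    by (subst lborel_pair.integral_fst'[OF i, symmetric]) simp
  ultimately show ?thesis by (simp add: has_bochner_integral_iff)
qed

text \<open>The squared modulus is the double integral of F(y) cnj (F(z)) k(x,y) cnj (k(x,z)), and
  Fubini lets x be integrated first, leaving the correlation \<open>M\<close> of the kernel. The
  bound \<open>B\<close>, uniform in y and z, makes the triple integrand absolutely integrable with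
  norm at most B times the square of the L1 norm of F. It is applied to a damped exponential and to
  a Gaussian convolution kernel.\<close>

lemma nn_integral_square_kernel:
  fixes F :: "'a::euclidean_space \<Rightarrow> complex" and k :: "'b::euclidean_space \<Rightarrow> 'a \<Rightarrow> complex"
  assumes F: "integrable lborel F"
    and k[measurable]: "(\<lambda>p. k (fst p) (snd p)) \<in> borel_measurable (borel \<Otimes>\<^sub>M borel)"
    and k1: "\<And>x y. norm (k x y) \<le> 1"
    and M: "\<And>y z. (\<integral>x. k x y * cnj (k x z) \<partial>lborel) = M y z"
    and B: "\<And>y z. (\<integral>\<^sup>+x. ennreal (norm (k x y * cnj (k x z))) \<partial>lborel) \<le> ennreal B"
  shows "(\<integral>\<^sup>+x. ennreal ((cmod (\<integral>y. F y * k x y \<partial>lborel))\<^sup>2) \<partial>lborel) =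
    ennreal (Re (\<integral>p. F (fst p) * cnj (F (snd p)) * M (fst p) (snd p) \<partial>(lborel \<Otimes>\<^sub>M lborel)))"
proof -
  let ?P = "lborel \<Otimes>\<^sub>M lborel :: ('a \<times> 'a) measure"
  interpret P: sigma_finite_measure ?P
    by (rule sigma_finite_pair_measure) (rule sigma_finite_lborel)+
  interpret Q: pair_sigma_finite "lborel :: 'b measure" ?P by standard
  have [measurable]: "F \<in> borel_measurable borel"
    using F by (auto dest: borel_measurable_integrable)
  have [measurable]: "k x \<in> borel_measurable borel" for x
    using measurable_compose[OF measurable_Pair1'[of x borel borel] k] by simp
  define K where "K x p = (F (fst p) * k x (fst p)) * (cnj (F (snd p)) * cnj (k x (snd p)))" for x p
  have [measurable]: "cnj \<in> borel_measurable borel" by (intro borel_measurable_continuous_onI continuous_intros)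
  have [measurable]: "case_prod K \<in> borel_measurable (lborel \<Otimes>\<^sub>M ?P)"
  proof -
    have "(\<lambda>q. k (fst q) (fst (snd q))) \<in> borel_measurable (borel \<Otimes>\<^sub>M (borel \<Otimes>\<^sub>M borel))"
      by (rule measurable_compose[OF _ k, where f = "\<lambda>q. (fst q, fst (snd q))", simplified]) measurable
    moreover have "(\<lambda>q. k (fst q) (snd (snd q))) \<in> borel_measurable (borel \<Otimes>\<^sub>M (borel \<Otimes>\<^sub>M borel))"
      by (rule measurable_compose[OF _ k, where f = "\<lambda>q. (fst q, snd (snd q))", simplified]) measurable
    ultimately show ?thesis unfolding K_def case_prod_beta
      by (measurable; simp cong: measurable_cong_sets)
  qed
  have intk: "integrable lborel (\<lambda>y. F y * k x y)" for x
    by (rule Bochner_Integration.integrable_bound[OF F]) (auto simp: norm_mult intro!: mult_right_le_one_le k1)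
  have Kx: "has_bochner_integral ?P (K x) (complex_of_real ((cmod (\<integral>y. F y * k x y \<partial>lborel))\<^sup>2))" for x
  proof -
    have ic: "integrable lborel (\<lambda>y. cnj (F y * k x y))"
      using intk[of x] by (simp only: complex_integrable_cnj)
    have "has_bochner_integral ?P (K x) ((\<integral>y. F y * k x y \<partial>lborel) * (\<integral>y. cnj (F y) * cnj (k x y) \<partial>lborel))"
      unfolding K_def using intk[of x] ic
      by (intro has_bochner_integral_lborel_pair_product) auto
    also have "(\<integral>y. cnj (F y) * cnj (k x y) \<partial>lborel) = cnj (\<integral>y. F y * k x y \<partial>lborel)"
      using Bochner_Integration.integral_cnj[where M=lborel and f= "\<lambda>y. F y * k x y"] by simp
    finally show ?thesis by (simp only: complex_norm_square)
  qed
  have "integrable (lborel \<Otimes>\<^sub>M ?P) (case_prod K)"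
    unfolding integrable_iff_bounded
  proof
    have "(\<integral>\<^sup>+q. ennreal (norm (case_prod K q)) \<partial>(lborel \<Otimes>\<^sub>M ?P)) = (\<integral>\<^sup>+p. \<integral>\<^sup>+x. ennreal (norm (K x p)) \<partial>lborel \<partial>?P)"
      by (subst Q.nn_integral_snd[symmetric]) (auto simp: case_prod_beta)
    also have "\<dots> = (\<integral>\<^sup>+p. \<integral>\<^sup>+x. ennreal (norm (F (fst p))) * ennreal (norm (F (snd p))) * ennreal (norm (k x (fst p) * cnj (k x (snd p)))) \<partial>lborel \<partial>?P)"
      by (intro nn_integral_cong) (simp add: K_def norm_mult mult_ac flip: ennreal_mult)
    also have "\<dots> \<le> (\<integral>\<^sup>+p. ennreal (norm (F (fst p))) * ennreal (norm (F (snd p))) * ennreal B \<partial>?P)"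
    proof (intro nn_integral_mono)
      fix p
      have [measurable]: "(\<lambda>x. k x y) \<in> borel_measurable borel" for y
        using measurable_compose[OF measurable_Pair2'[of y borel borel] k] by simp
      show "(\<integral>\<^sup>+x. ennreal (norm (F (fst p))) * ennreal (norm (F (snd p))) * ennreal (norm (k x (fst p) * cnj (k x (snd p)))) \<partial>lborel) \<le> ennreal (norm (F (fst p))) * ennreal (norm (F (snd p))) * ennreal B"
        by (subst nn_integral_cmult) (auto intro!: mult_left_mono B)
    qed
    also have "\<dots> = (\<integral>\<^sup>+x. ennreal (norm (F x)) \<partial>lborel) * (\<integral>\<^sup>+x. ennreal (norm (F x)) \<partial>lborel) * ennreal B"
      using nn_integral_lborel_pair_product[of "\<lambda>x. ennreal (norm (F x))" "\<lambda>x. ennreal (norm (F x))"]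
      by (simp add: nn_integral_multc)
    also have "\<dots> < \<infinity>" using F by (auto simp: integrable_iff_bounded ennreal_mult_less_top)
    finally show "(\<integral>\<^sup>+q. ennreal (norm (case_prod K q)) \<partial>(lborel \<Otimes>\<^sub>M ?P)) < \<infinity>" .
  qed simp
  note int = this
  have eq: "integral\<^sup>L ?P (K x) = complex_of_real ((cmod (\<integral>y. F y * k x y \<partial>lborel))\<^sup>2)" for x
    using Kx by (simp add: has_bochner_integral_iff)
  have "integrable lborel (\<lambda>x. complex_of_real ((cmod (\<integral>y. F y * k x y \<partial>lborel))\<^sup>2))"
    using Q.integrable_fst[OF int] by (simp only: eq)
  then have i2: "integrable lborel (\<lambda>x. (cmod (\<integral>y. F y * k x y \<partial>lborel))\<^sup>2)"
    using complex_of_real_integrable_eq by blast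
  then have "(\<integral>\<^sup>+x. ennreal ((cmod (\<integral>y. F y * k x y \<partial>lborel))\<^sup>2) \<partial>lborel) =
     ennreal (\<integral>x. (cmod (\<integral>y. F y * k x y \<partial>lborel))\<^sup>2 \<partial>lborel)"
    by (intro nn_integral_eq_integral) auto
  also have "(\<integral>x. (cmod (\<integral>y. F y * k x y \<partial>lborel))\<^sup>2 \<partial>lborel) = Re (\<integral>x. integral\<^sup>L ?P (K x) \<partial>lborel)"
    unfolding eq by (simp flip: of_real_power)
  also have "(\<integral>x. integral\<^sup>L ?P (K x) \<partial>lborel) = (\<integral>p. (\<integral>x. K x p \<partial>lborel) \<partial>?P)"
    using Q.Fubini_integral[OF int] by simp
  also have "\<dots> = (\<integral>p. F (fst p) * cnj (F (snd p)) * M (fst p) (snd p) \<partial>?P)"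
  proof (intro Bochner_Integration.integral_cong refl)
    fix p
    have "K x p = F (fst p) * cnj (F (snd p)) * (k x (fst p) * cnj (k x (snd p)))" for x
      by (simp add: K_def)
    then show "(\<integral>x. K x p \<partial>lborel) = F (fst p) * cnj (F (snd p)) * M (fst p) (snd p)"
      by (simp add: M)
  qed
  finally show ?thesis .
qed

text \<open>Both sides of the regularised Plancherel identity are multiples of this quadratic form.\<close>

definition gauss_form :: "real \<Rightarrow> ('a::euclidean_space \<Rightarrow> complex) \<Rightarrow> real" where
  "gauss_form a F = Re (\<integral>p. F (fst p) * cnj (F (snd p)) *
     complex_of_real (exp (- (norm (fst p - snd p))\<^sup>2 / (4 * a))) \<partial>(lborel \<Otimes>\<^sub>M lborel))"

lemma nn_integral_fourier_gauss:
  fixes F :: "'a::euclidean_space \<Rightarrow> complex"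
  assumes F: "integrable lborel F" and a: "a > 0"
  shows "(\<integral>\<^sup>+x. ennreal ((cmod (\<integral>y. F y * iexp (x \<bullet> y) \<partial>lborel))\<^sup>2 * exp (- a * (norm x)\<^sup>2)) \<partial>lborel) =
    ennreal (sqrt (pi / a) ^ DIM('a) * gauss_form a F)"
proof -
  \<comment> \<open>Half of the damping exponent goes into the kernel, since the kernel enters
    squared. Its correlation is then the Gaussian Fourier transform at y - z.\<close>
  define k where "k x y = iexp (x \<bullet> y) * complex_of_real (exp (- (a / 2) * (norm x)\<^sup>2))" for x y :: 'a
  have kk: "k x y * cnj (k x z) = iexp (x \<bullet> (y - z)) * complex_of_real (exp (- a * (norm x)\<^sup>2))" for x y z
  proof -
    have "complex_of_real (exp (- (a / 2) * (norm x)\<^sup>2)) * complex_of_real (exp (- (a / 2) * (norm x)\<^sup>2)) = complex_of_real (exp (- a * (norm x)\<^sup>2))"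
      by (simp flip: of_real_mult exp_add)
    moreover have "iexp (x \<bullet> y) * cnj (iexp (x \<bullet> z)) = iexp (x \<bullet> (y - z))"
      by (simp add: exp_cnj inner_diff_right algebra_simps flip: exp_add)
    moreover have "k x y * cnj (k x z) = (iexp (x \<bullet> y) * cnj (iexp (x \<bullet> z))) *
        (complex_of_real (exp (- (a / 2) * (norm x)\<^sup>2)) * complex_of_real (exp (- (a / 2) * (norm x)\<^sup>2)))"
      by (simp only: k_def complex_cnj_mult complex_cnj_complex_of_real mult_ac)
    ultimately show ?thesis by (simp only:)
  qed
  have M: "(\<integral>x. k x y * cnj (k x z) \<partial>lborel) = complex_of_real (sqrt (pi / a) ^ DIM('a)) * complex_of_real (exp (- (norm (y - z))\<^sup>2 / (4 * a)))" for y z :: 'a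
    unfolding kk using gauss_fourier[OF a, of "y - z"] by (simp add: has_bochner_integral_iff)
  have B: "(\<integral>\<^sup>+x. ennreal (norm (k x y * cnj (k x z))) \<partial>lborel) \<le> ennreal (sqrt (pi / a) ^ DIM('a))" for y z :: 'a
    unfolding kk using gauss_integral[OF a, of "0::'a"]
    by (simp add: norm_mult has_bochner_integral_iff nn_integral_eq_integral)
  have k1: "norm (k x y) \<le> 1" for x y
    using a by (simp add: k_def norm_mult)
  have km: "(\<lambda>p. k (fst p) (snd p)) \<in> borel_measurable (borel \<Otimes>\<^sub>M borel)"
    unfolding k_def borel_prod by (intro borel_measurable_continuous_onI continuous_intros)
  have "F y * k x y = (F y * iexp (x \<bullet> y)) * complex_of_real (exp (- (a / 2) * (norm x)\<^sup>2))" for x y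
    by (simp add: k_def)
  then have "(\<integral>y. F y * k x y \<partial>lborel) = (\<integral>y. F y * iexp (x \<bullet> y) \<partial>lborel) * complex_of_real (exp (- (a / 2) * (norm x)\<^sup>2))" for x
    by (simp only: integral_mult_left_zero)
  moreover have "(exp (- (a / 2) * (norm x)\<^sup>2))\<^sup>2 = exp (- a * (norm (x::'a))\<^sup>2)" for x
    by (simp add: power2_eq_square flip: exp_add)
  ultimately have *: "(cmod (\<integral>y. F y * k x y \<partial>lborel))\<^sup>2 = (cmod (\<integral>y. F y * iexp (x \<bullet> y) \<partial>lborel))\<^sup>2 * exp (- a * (norm x)\<^sup>2)" for x
    by (simp add: norm_mult power_mult_distrib)
  have M2: "F (fst p) * cnj (F (snd p)) * (complex_of_real c * complex_of_real b) = complex_of_real c * (F (fst p) * cnj (F (snd p)) * complex_of_real b)" for p b c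
    by simp
  have Re_scale: "Re (complex_of_real c * z) = c * Re z" for c z by simp
  show ?thesis
    using nn_integral_square_kernel[OF F km k1 M B] unfolding * M2 gauss_form_def
      by (simp only: integral_mult_right_zero Re_scale)
qed

text \<open>The width 2a is the one for which the correlation of the kernel is again a multiple of
  exp (-|y - z|^2 / (4a)), so that the same \<open>gauss_form a F\<close> appears as on the Fourier
  side.\<close>

lemma nn_integral_gauss_convolution:
  fixes F :: "'a::euclidean_space \<Rightarrow> complex"
  assumes F: "integrable lborel F" and a: "a > 0"
  shows "(\<integral>\<^sup>+w. ennreal ((cmod (\<integral>y. F y * complex_of_real (exp (- (norm (w - y))\<^sup>2 / (2 * a))) \<partial>lborel))\<^sup>2) \<partial>lborel) =
    ennreal (sqrt (pi * a) ^ DIM('a) * gauss_form a F)"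
proof -
  define k where "k w y = complex_of_real (exp (- (norm (w - y))\<^sup>2 / (2 * a)))" for w y :: 'a
  have kk: "k w y * cnj (k w z) = complex_of_real (exp (- (norm (y - z))\<^sup>2 / (4 * a))) *
     complex_of_real (exp (- (1 / a) * (norm (w - (1 / 2) *\<^sub>R (y + z)))\<^sup>2))" for w y z
  proof -
    \<comment> \<open>Parallelogram law about the midpoint of y and z: it separates the dependence
      on y - z from a Gaussian in w.\<close>
    have "(norm (w - y))\<^sup>2 + (norm (w - z))\<^sup>2 = (norm (y - z))\<^sup>2 / 2 + 2 * (norm (w - (1 / 2) *\<^sub>R (y + z)))\<^sup>2"
      by (simp add: power2_norm_eq_inner inner_diff_left inner_diff_right inner_add_left inner_add_right inner_commute field_simps)
    moreover have "- A / (2 * a) + - B / (2 * a) = - P / (4 * a) + - (1 / a) * R" if "A + B = P / 2 + 2 * R" for A B P R :: real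
    proof -
      have *: "B = P / 2 + 2 * R - A" using that by simp
      show ?thesis unfolding * using a by (simp add: field_simps)
    qed
    ultimately have "- (norm (w - y))\<^sup>2 / (2 * a) + - (norm (w - z))\<^sup>2 / (2 * a) = - (norm (y - z))\<^sup>2 / (4 * a) + - (1 / a) * (norm (w - (1 / 2) *\<^sub>R (y + z)))\<^sup>2"
      by blast
    then show ?thesis
      by (simp add: k_def flip: of_real_mult exp_add)
  qed
  have a1: "1 / a > 0" using a by simp
  have M: "(\<integral>x. k x y * cnj (k x z) \<partial>lborel) = complex_of_real (sqrt (pi * a) ^ DIM('a)) * complex_of_real (exp (- (norm (y - z))\<^sup>2 / (4 * a)))" for y z :: 'a
    unfolding kk using gauss_integral[OF a1, of "(1/2) *\<^sub>R (y + z)"] by (simp add: has_bochner_integral_iff)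
  have B: "(\<integral>\<^sup>+x. ennreal (norm (k x y * cnj (k x z))) \<partial>lborel) \<le> ennreal (sqrt (pi * a) ^ DIM('a))" for y z :: 'a
  proof -
    have "(\<integral>\<^sup>+x. ennreal (norm (k x y * cnj (k x z))) \<partial>lborel) \<le> (\<integral>\<^sup>+x. ennreal (exp (- (1 / a) * (norm (x - (1 / 2) *\<^sub>R (y + z)))\<^sup>2)) \<partial>lborel)"
      unfolding kk using a by (intro nn_integral_mono) (auto simp: norm_mult intro!: ennreal_leI mult_left_le_one_le)
    also have "\<dots> = ennreal (sqrt (pi * a) ^ DIM('a))"
      using gauss_integral[OF a1, of "(1/2) *\<^sub>R (y + z)"] by (simp add: has_bochner_integral_iff nn_integral_eq_integral)
    finally show ?thesis .
  qed
  have k1: "norm (k x y) \<le> 1" for x y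
    using a by (simp add: k_def)
  have km: "(\<lambda>p. k (fst p) (snd p)) \<in> borel_measurable (borel \<Otimes>\<^sub>M borel)"
    unfolding k_def borel_prod using a by (intro borel_measurable_continuous_onI continuous_intros) auto
  have M2: "F (fst p) * cnj (F (snd p)) * (complex_of_real c * complex_of_real b) = complex_of_real c * (F (fst p) * cnj (F (snd p)) * complex_of_real b)" for p b c
    by simp
  have Re_scale: "Re (complex_of_real c * z) = c * Re z" for c z by simp
  show ?thesis
    using nn_integral_square_kernel[OF F km k1 M B] unfolding M2 gauss_form_def k_def
    by (simp only: integral_mult_right_zero Re_scale)
qed

text \<open>A Schur-type bound: |F(y) F(z)| is at most the mean of |F(y)|^2 and |F(z)|^2, the kernel
  is symmetric, and its integral in either variable is sqrt (4 pi a)^N, with N the dimension. The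
  right-hand side may be infinite.\<close>

lemma gauss_form_le:
  fixes F :: "'a::euclidean_space \<Rightarrow> complex"
  assumes F: "integrable lborel F" and a: "a > 0"
  shows "ennreal (gauss_form a F) \<le> ennreal (sqrt (4 * pi * a) ^ DIM('a)) * (\<integral>\<^sup>+y. ennreal ((cmod (F y))\<^sup>2) \<partial>lborel)"
proof -
  let ?P = "lborel \<Otimes>\<^sub>M lborel :: ('a \<times> 'a) measure"
  have [measurable]: "F \<in> borel_measurable borel"
    using F by (auto dest: borel_measurable_integrable)
  define E where "E y z = exp (- (norm (y - z))\<^sup>2 / (4 * a))" for y z :: 'a
  have E_commute: "E y z = E z y" for y z by (simp add: E_def norm_minus_commute)
  have Em[measurable]: "(\<lambda>p. E (fst p) (snd p)) \<in> borel_measurable (borel \<Otimes>\<^sub>M borel)"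
    unfolding E_def borel_prod using a by (intro borel_measurable_continuous_onI continuous_intros) auto
  have [measurable]: "E y \<in> borel_measurable borel" for y
    unfolding E_def using a by (intro borel_measurable_continuous_onI continuous_intros) auto
  have E0: "E y z \<ge> 0" "E y z \<le> 1" for y z using a by (auto simp: E_def)
  have EI: "(\<integral>\<^sup>+z. ennreal (E y z) \<partial>lborel) = ennreal (sqrt (4 * pi * a) ^ DIM('a))" for y
    using gauss_integral[of "1 / (4 * a)" y] a
    by (subst E_commute) (simp add: E_def has_bochner_integral_iff nn_integral_eq_integral mult_ac)
  let ?f = "\<lambda>p. F (fst p) * cnj (F (snd p)) * complex_of_real (E (fst p) (snd p))"
  have i: "integrable ?P ?f"
  proof (rule Bochner_Integration.integrable_bound)
    show "integrable ?P (\<lambda>p. F (fst p) * cnj (F (snd p)))"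
      using has_bochner_integral_lborel_pair_product[OF F, of "\<lambda>y. cnj (F y)"] F by (simp add: has_bochner_integral_iff)
    have "cnj \<in> borel_measurable borel" by (intro borel_measurable_continuous_onI continuous_intros)
    then show "?f \<in> borel_measurable ?P" by measurable
  qed (auto simp: norm_mult E0 intro!: mult_right_le_one_le)
  have "ennreal (gauss_form a F) \<le> ennreal (norm (integral\<^sup>L ?P ?f))"
    unfolding gauss_form_def E_def by (intro ennreal_leI complex_Re_le_cmod)
  also have "\<dots> \<le> (\<integral>\<^sup>+p. ennreal (norm (?f p)) \<partial>?P)"
    using i by (rule integral_norm_bound_ennreal)
  also have "\<dots> \<le> (\<integral>\<^sup>+p. ennreal ((cmod (F (fst p)))\<^sup>2 / 2) * ennreal (E (fst p) (snd p)) +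
                       ennreal ((cmod (F (snd p)))\<^sup>2 / 2) * ennreal (E (fst p) (snd p)) \<partial>?P)"
  proof (intro nn_integral_mono)
    fix p
    have "2 * (cmod (F (fst p)) * cmod (F (snd p))) \<le> (cmod (F (fst p)))\<^sup>2 + (cmod (F (snd p)))\<^sup>2"
      using sum_squares_bound[of "cmod (F (fst p))" "cmod (F (snd p))"] by (simp add: mult_ac)
    then have "cmod (F (fst p)) * cmod (F (snd p)) * E (fst p) (snd p) \<le> ((cmod (F (fst p)))\<^sup>2 / 2 + (cmod (F (snd p)))\<^sup>2 / 2) * E (fst p) (snd p)"
      by (intro mult_right_mono E0) simp
    then show "ennreal (norm (?f p)) \<le> ennreal ((cmod (F (fst p)))\<^sup>2 / 2) * ennreal (E (fst p) (snd p)) +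
                       ennreal ((cmod (F (snd p)))\<^sup>2 / 2) * ennreal (E (fst p) (snd p))"
      by (simp add: norm_mult E0 distrib_right ennreal_leI flip: ennreal_mult ennreal_plus)
  qed
  also have "\<dots> = (\<integral>\<^sup>+p. ennreal ((cmod (F (fst p)))\<^sup>2 / 2) * ennreal (E (fst p) (snd p)) \<partial>?P) +
                 (\<integral>\<^sup>+p. ennreal ((cmod (F (snd p)))\<^sup>2 / 2) * ennreal (E (fst p) (snd p)) \<partial>?P)"
    by (intro nn_integral_add) measurable
  also have "(\<integral>\<^sup>+p. ennreal ((cmod (F (fst p)))\<^sup>2 / 2) * ennreal (E (fst p) (snd p)) \<partial>?P) =
     (\<integral>\<^sup>+y. ennreal ((cmod (F y))\<^sup>2 / 2) \<partial>lborel) * ennreal (sqrt (4 * pi * a) ^ DIM('a))"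
    by (subst lborel.nn_integral_fst[symmetric]) (auto simp: nn_integral_cmult nn_integral_multc EI)
  also have "(\<integral>\<^sup>+p. ennreal ((cmod (F (snd p)))\<^sup>2 / 2) * ennreal (E (fst p) (snd p)) \<partial>?P) =
     (\<integral>\<^sup>+y. ennreal ((cmod (F y))\<^sup>2 / 2) \<partial>lborel) * ennreal (sqrt (4 * pi * a) ^ DIM('a))"
    by (subst lborel_pair.nn_integral_snd[symmetric]) (auto simp: nn_integral_cmult nn_integral_multc E_commute[of _ "_::'a"] EI)
  also have "(\<integral>\<^sup>+y. ennreal ((cmod (F y))\<^sup>2 / 2) \<partial>lborel) * ennreal (sqrt (4 * pi * a) ^ DIM('a)) +
     (\<integral>\<^sup>+y. ennreal ((cmod (F y))\<^sup>2 / 2) \<partial>lborel) * ennreal (sqrt (4 * pi * a) ^ DIM('a)) =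
     ((\<integral>\<^sup>+y. ennreal ((cmod (F y))\<^sup>2 / 2) \<partial>lborel) + (\<integral>\<^sup>+y. ennreal ((cmod (F y))\<^sup>2 / 2) \<partial>lborel)) * ennreal (sqrt (4 * pi * a) ^ DIM('a))"
    by (simp add: distrib_right)
  also have "(\<integral>\<^sup>+y. ennreal ((cmod (F y))\<^sup>2 / 2) \<partial>lborel) + (\<integral>\<^sup>+y. ennreal ((cmod (F y))\<^sup>2 / 2) \<partial>lborel) = (\<integral>\<^sup>+y. ennreal ((cmod (F y))\<^sup>2) \<partial>lborel)"
    by (subst nn_integral_add[symmetric]) (auto simp flip: ennreal_plus)
  finally show ?thesis by (simp add: mult.commute)
qed

section \<open>Gaussian mollification and its convergence in L1\<close>

definition gauss_smooth :: "real \<Rightarrow> ('a::euclidean_space \<Rightarrow> complex) \<Rightarrow> 'a \<Rightarrow> complex" where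
  "gauss_smooth a F w = complex_of_real (1 / sqrt (2 * pi * a) ^ DIM('a)) *
     (\<integral>y. F y * complex_of_real (exp (- (norm (w - y))\<^sup>2 / (2 * a))) \<partial>lborel)"

text \<open>Both sides are multiples of \<open>gauss_form a F\<close>, and the constants agree in
  each dimension: 2 pi * (1 / (2 pi a)) * sqrt (pi a) = sqrt (pi / a). This is Plancherel's identity
  for the mollified function, exact for every a > 0.\<close>

lemma gauss_smooth_square:
  fixes F :: "'a::euclidean_space \<Rightarrow> complex"
  assumes F: "integrable lborel F" and a: "a > 0"
  shows "ennreal ((2 * pi) ^ DIM('a)) * (\<integral>\<^sup>+w. ennreal ((cmod (gauss_smooth a F w))\<^sup>2) \<partial>lborel) =
    (\<integral>\<^sup>+x. ennreal ((cmod (\<integral>y. F y * iexp (x \<bullet> y) \<partial>lborel))\<^sup>2 * exp (- a * (norm x)\<^sup>2)) \<partial>lborel)"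
proof -
  define c where "c = 1 / sqrt (2 * pi * a) ^ DIM('a)"
  have c: "c \<ge> 0" using a by (simp add: c_def)
  have [measurable]: "F \<in> borel_measurable borel"
    using F by (auto dest: borel_measurable_integrable)
  have km[measurable]: "(\<lambda>p. complex_of_real (exp (- (norm (fst p - snd p :: 'a))\<^sup>2 / (2 * a)))) \<in> borel_measurable (borel \<Otimes>\<^sub>M borel)"
    unfolding borel_prod using a by (intro borel_measurable_continuous_onI continuous_intros) auto
  have [measurable]: "(\<lambda>w. (\<integral>y. F y * complex_of_real (exp (- (norm (w - y))\<^sup>2 / (2 * a))) \<partial>lborel)) \<in> borel_measurable lborel"
    by (rule lborel.borel_measurable_lebesgue_integral) (use km in \<open>auto simp: case_prod_beta\<close>)
  have "(\<integral>\<^sup>+w. ennreal ((cmod (gauss_smooth a F w))\<^sup>2) \<partial>lborel) =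
     (\<integral>\<^sup>+w. ennreal (c\<^sup>2) * ennreal ((cmod (\<integral>y. F y * complex_of_real (exp (- (norm (w - y))\<^sup>2 / (2 * a))) \<partial>lborel))\<^sup>2) \<partial>lborel)"
    unfolding gauss_smooth_def c_def[symmetric] using c
    by (intro nn_integral_cong) (simp add: norm_mult power_mult_distrib ennreal_mult)
  also have "\<dots> = ennreal (c\<^sup>2) * ennreal (sqrt (pi * a) ^ DIM('a) * gauss_form a F)"
    by (subst nn_integral_cmult, measurable, simp only: nn_integral_gauss_convolution[OF F a])
  finally have "ennreal ((2 * pi) ^ DIM('a)) * (\<integral>\<^sup>+w. ennreal ((cmod (gauss_smooth a F w))\<^sup>2) \<partial>lborel) =
    ennreal ((2 * pi) ^ DIM('a) * c\<^sup>2 * sqrt (pi * a) ^ DIM('a)) * ennreal (gauss_form a F)"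
    using a c by (simp add: ennreal_mult' mult.assoc)
  also have "(2 * pi) ^ DIM('a) * c\<^sup>2 * sqrt (pi * a) ^ DIM('a) = (2 * pi * (1 / sqrt (2 * pi * a))\<^sup>2 * sqrt (pi * a)) ^ DIM('a)"
  proof -
    have "c = (1 / sqrt (2 * pi * a)) ^ DIM('a)" by (simp add: c_def power_one_over)
    then show ?thesis by (simp only: power_mult_distrib power2_eq_square)
  qed
  also have "2 * pi * (1 / sqrt (2 * pi * a))\<^sup>2 * sqrt (pi * a) = sqrt (pi / a)"
    using a by (simp add: power_divide real_sqrt_mult real_sqrt_divide field_simps)
  also have "ennreal (sqrt (pi / a) ^ DIM('a)) * ennreal (gauss_form a F) = ennreal (sqrt (pi / a) ^ DIM('a) * gauss_form a F)"
    using a by (simp add: ennreal_mult')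
  finally show ?thesis by (simp only: nn_integral_fourier_gauss[OF F a])
qed

text \<open>The mollifier has mass 1, so the difference is an average of F(y) - F(w). After y = w +
  sqrt a z the Gaussian in z no longer depends on a, which remains only in the size of the
  translation; exchanging the integrals gives L1 norms of translation differences.\<close>

lemma gauss_smooth_L1_dist:
  fixes F :: "'a::euclidean_space \<Rightarrow> complex"
  assumes F: "integrable lborel F" and a: "a > 0"
  shows "(\<integral>\<^sup>+w. ennreal (norm (gauss_smooth a F w - F w)) \<partial>lborel) \<le>
    (\<integral>\<^sup>+z. ennreal (1 / sqrt (2 * pi) ^ DIM('a) * exp (- (norm z)\<^sup>2 / 2)) *
        (\<integral>\<^sup>+w. ennreal (norm (F (sqrt a *\<^sub>R z + w) - F w)) \<partial>lborel) \<partial>lborel)"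
proof -
  define c where "c = 1 / sqrt (2 * pi * a) ^ DIM('a)"
  have c: "c \<ge> 0" using a by (simp add: c_def)
  have Fm[measurable]: "F \<in> borel_measurable borel"
    using F by (auto dest: borel_measurable_integrable)
  let ?e = "\<lambda>w y :: 'a. exp (- (norm (w - y))\<^sup>2 / (2 * a))"
  have [measurable]: "?e w \<in> borel_measurable borel" for w
    using a by (intro borel_measurable_continuous_onI continuous_intros) auto
  have e1: "has_bochner_integral lborel (?e w) (sqrt (2 * pi * a) ^ DIM('a))" for w
    using gauss_integral[of "1 / (2 * a)" w] a by (simp add: norm_minus_commute mult_ac)
  have i1: "integrable lborel (\<lambda>y. F y * complex_of_real (?e w y))" for w
    by (rule Bochner_Integration.integrable_bound[OF F]) (use a in \<open>auto simp: norm_mult intro!: mult_right_le_one_le\<close>)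
  have i2: "integrable lborel (\<lambda>y. F w * complex_of_real (?e w y))" for w
    using e1[of w] by (auto simp: has_bochner_integral_iff)
  have eq: "gauss_smooth a F w - F w = complex_of_real c * (\<integral>y. (F y - F w) * complex_of_real (?e w y) \<partial>lborel)" for w
  proof -
    have "complex_of_real c * (\<integral>y. F w * complex_of_real (?e w y) \<partial>lborel) = complex_of_real c * (F w * complex_of_real (sqrt (2 * pi * a) ^ DIM('a)))"
      using e1[of w] by (simp add: has_bochner_integral_iff)
    also have "\<dots> = F w" using a by (simp add: c_def)
    finally have "gauss_smooth a F w - F w = complex_of_real c * (\<integral>y. F y * complex_of_real (?e w y) \<partial>lborel) - complex_of_real c * (\<integral>y. F w * complex_of_real (?e w y) \<partial>lborel)"
      by (simp add: gauss_smooth_def c_def)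
    also have "\<dots> = complex_of_real c * (\<integral>y. F y * complex_of_real (?e w y) - F w * complex_of_real (?e w y) \<partial>lborel)"
      by (subst Bochner_Integration.integral_diff[OF i1 i2]) (simp add: right_diff_distrib)
    finally show ?thesis by (simp add: left_diff_distrib)
  qed
  let ?g = "\<lambda>z::'a. 1 / sqrt (2 * pi) ^ DIM('a) * exp (- (norm z)\<^sup>2 / 2)"
  have [measurable]: "?g \<in> borel_measurable borel"
    by (intro borel_measurable_continuous_onI continuous_intros) auto
  have bound: "ennreal (norm (gauss_smooth a F w - F w)) \<le> (\<integral>\<^sup>+z. ennreal (?g z) * ennreal (norm (F (sqrt a *\<^sub>R z + w) - F w)) \<partial>lborel)" for w
  proof -
    have "ennreal (norm (gauss_smooth a F w - F w)) = ennreal c * ennreal (norm (\<integral>y. (F y - F w) * complex_of_real (?e w y) \<partial>lborel))"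
      using c by (simp add: eq norm_mult ennreal_mult)
    also have "\<dots> \<le> ennreal c * (\<integral>\<^sup>+y. ennreal (norm ((F y - F w) * complex_of_real (?e w y))) \<partial>lborel)"
      using Bochner_Integration.integrable_diff[OF i1[of w] i2[of w]]
      by (intro mult_left_mono integral_norm_bound_ennreal) (auto simp: left_diff_distrib)
    also have "(\<integral>\<^sup>+y. ennreal (norm ((F y - F w) * complex_of_real (?e w y))) \<partial>lborel) =
       ennreal (sqrt a ^ DIM('a)) * (\<integral>\<^sup>+z. ennreal (norm ((F (w + sqrt a *\<^sub>R z) - F w) * complex_of_real (?e w (w + sqrt a *\<^sub>R z)))) \<partial>lborel)"
      using a by (subst nn_integral_lborel_scale[of _ "sqrt a" w]) auto
    also have "ennreal c * \<dots> = (\<integral>\<^sup>+z. ennreal (c * sqrt a ^ DIM('a)) * ennreal (norm ((F (w + sqrt a *\<^sub>R z) - F w) * complex_of_real (?e w (w + sqrt a *\<^sub>R z)))) \<partial>lborel)"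
      using c a by (subst nn_integral_cmult) (auto simp: ennreal_mult mult.assoc)
    also have "\<dots> = (\<integral>\<^sup>+z. ennreal (?g z) * ennreal (norm (F (sqrt a *\<^sub>R z + w) - F w)) \<partial>lborel)"
    proof (intro nn_integral_cong)
      fix z :: 'a
      have "c * sqrt a ^ DIM('a) = 1 / sqrt (2 * pi) ^ DIM('a)"
        using a by (simp add: c_def real_sqrt_mult power_mult_distrib)
      moreover have "?e w (w + sqrt a *\<^sub>R z) = exp (- (norm z)\<^sup>2 / 2)"
        using a by (simp add: power_mult_distrib)
      ultimately show "ennreal (c * sqrt a ^ DIM('a)) * ennreal (norm ((F (w + sqrt a *\<^sub>R z) - F w) * complex_of_real (?e w (w + sqrt a *\<^sub>R z)))) = ennreal (?g z) * ennreal (norm (F (sqrt a *\<^sub>R z + w) - F w))"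
        by (simp add: norm_mult add.commute mult_ac flip: ennreal_mult)
    qed
    finally show ?thesis .
  qed
  have "(\<integral>\<^sup>+w. ennreal (norm (gauss_smooth a F w - F w)) \<partial>lborel) \<le>
    (\<integral>\<^sup>+w. \<integral>\<^sup>+z. ennreal (?g z) * ennreal (norm (F (sqrt a *\<^sub>R z + w) - F w)) \<partial>lborel \<partial>lborel)"
    by (intro nn_integral_mono bound)
  also have "\<dots> = (\<integral>\<^sup>+z. \<integral>\<^sup>+w. ennreal (?g z) * ennreal (norm (F (sqrt a *\<^sub>R z + w) - F w)) \<partial>lborel \<partial>lborel)"
    by (rule lborel_pair.Fubini') measurable
  also have "\<dots> = (\<integral>\<^sup>+z. ennreal (?g z) * (\<integral>\<^sup>+w. ennreal (norm (F (sqrt a *\<^sub>R z + w) - F w)) \<partial>lborel) \<partial>lborel)"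
    by (intro nn_integral_cong nn_integral_cmult) measurable
  finally show ?thesis .
qed

text \<open>Dominated convergence in z: the translation difference \<omega> tends to 0 at 0 and is
  bounded by twice the L1 norm of F, while the Gaussian weight has mass 1. The finiteness makes the
  differences Bochner integrable, as the extraction of an a.e. convergent subsequence
  requires.\<close>

lemma gauss_smooth_tendsto_L1:
  fixes F :: "'a::euclidean_space \<Rightarrow> complex"
  assumes F: "integrable lborel F" and a: "\<And>n. a n > 0" "a \<longlonglongrightarrow> 0"
  shows "(\<lambda>n. \<integral>\<^sup>+w. ennreal (norm (gauss_smooth (a n) F w - F w)) \<partial>lborel) \<longlonglongrightarrow> 0"
    and "(\<integral>\<^sup>+w. ennreal (norm (gauss_smooth (a n) F w - F w)) \<partial>lborel) < \<infinity>"
proof -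
  have Fm[measurable]: "F \<in> borel_measurable borel"
    using F by (auto dest: borel_measurable_integrable)
  define g where "g z = 1 / sqrt (2 * pi) ^ DIM('a) * exp (- (norm (z::'a))\<^sup>2 / 2)" for z
  have g0: "g z \<ge> 0" for z by (simp add: g_def)
  have [measurable]: "g \<in> borel_measurable borel"
    unfolding g_def by (intro borel_measurable_continuous_onI continuous_intros) auto
  have gi: "(\<integral>\<^sup>+z. ennreal (g z) \<partial>lborel) = 1"
  proof -
    have "has_bochner_integral lborel (\<lambda>x::'a. exp (- (1 / 2) * (norm (x - 0))\<^sup>2)) (sqrt (pi / (1 / 2)) ^ DIM('a))"
      by (rule gauss_integral) simp
    then have "has_bochner_integral lborel (\<lambda>x::'a. 1 / sqrt (2 * pi) ^ DIM('a) * exp (- (1 / 2) * (norm (x - 0))\<^sup>2))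
        (1 / sqrt (2 * pi) ^ DIM('a) * sqrt (pi / (1 / 2)) ^ DIM('a))"
      by (rule has_bochner_integral_mult_right)
    then have "has_bochner_integral lborel g 1"
      by (simp add: g_def[abs_def] mult_ac)
    then show ?thesis by (simp add: has_bochner_integral_iff nn_integral_eq_integral g0)
  qed
  define \<omega> where "\<omega> h = (\<integral>\<^sup>+w. ennreal (norm (F (h + w) - F w)) \<partial>lborel)" for h
  define N where "N = (\<integral>\<^sup>+w. ennreal (norm (F w)) \<partial>lborel)"
  have N: "N < \<infinity>" using F by (simp add: N_def integrable_iff_bounded)
  have [measurable]: "\<omega> \<in> borel_measurable borel"
  proof -
    have "(\<lambda>p. ennreal (norm (F (fst p + snd p) - F (snd p)))) \<in> borel_measurable (borel \<Otimes>\<^sub>M lborel)"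
      by measurable
    from lborel.borel_measurable_nn_integral_fst[OF this] show ?thesis
      unfolding \<omega>_def by (simp cong: measurable_cong_sets)
  qed
  have \<omega>_le: "\<omega> h \<le> 2 * N" for h
  proof -
    have "\<omega> h \<le> (\<integral>\<^sup>+w. ennreal (norm (F (h + w))) + ennreal (norm (F w)) \<partial>lborel)"
      unfolding \<omega>_def by (intro nn_integral_mono) (simp add: norm_triangle_ineq4 flip: ennreal_plus)
    also have "\<dots> = N + N"
      unfolding N_def by (subst nn_integral_add) (auto simp: nn_integral_lborel_translate[of "\<lambda>w. ennreal (norm (F w))"])
    finally show ?thesis by (simp add: mult_2)
  qed
  have bound: "(\<integral>\<^sup>+w. ennreal (norm (gauss_smooth (a n) F w - F w)) \<partial>lborel) \<le> (\<integral>\<^sup>+z. ennreal (g z) * \<omega> (sqrt (a n) *\<^sub>R z) \<partial>lborel)" for n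
    using gauss_smooth_L1_dist[OF F a(1), of n] by (simp only: g_def \<omega>_def)
  have dom: "ennreal (g z) * \<omega> (sqrt (a n) *\<^sub>R z) \<le> ennreal (g z) * (2 * N)" for n z
    by (intro mult_left_mono \<omega>_le) auto
  have fin: "(\<integral>\<^sup>+z. ennreal (g z) * (2 * N) \<partial>lborel) < \<infinity>"
    using N gi by (simp add: nn_integral_multc ennreal_mult_less_top)
  have "(\<lambda>n. \<integral>\<^sup>+z. ennreal (g z) * \<omega> (sqrt (a n) *\<^sub>R z) \<partial>lborel) \<longlonglongrightarrow> integral\<^sup>N lborel (\<lambda>z::'a. 0)"
  proof (rule nn_integral_dominated_convergence[where w="\<lambda>z. ennreal (g z) * (2 * N)"])
    show "AE z in lborel. (\<lambda>n. ennreal (g z) * \<omega> (sqrt (a n) *\<^sub>R z)) \<longlonglongrightarrow> 0"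
    proof (rule AE_I2)
      fix z :: 'a
      have "(\<lambda>n. \<omega> (sqrt (a n) *\<^sub>R z)) \<longlonglongrightarrow> 0"
      proof (rule order_tendstoI)
        fix e :: ennreal assume "0 < e"
        then obtain e' where e': "0 < e'" "ennreal e' < e"
          by (metis dense ennreal_cases ennreal_less_zero_iff less_top_ennreal order_less_trans top.not_eq_extremum)
        obtain d where d: "d > 0" "\<And>h. norm h < d \<Longrightarrow> \<omega> h \<le> ennreal e'"
          using translation_continuous_L1[OF F e'(1)] unfolding \<omega>_def by blast
        have "(\<lambda>n. sqrt (a n) *\<^sub>R z) \<longlonglongrightarrow> sqrt 0 *\<^sub>R z" by (intro tendsto_intros a)
        then have "eventually (\<lambda>n. norm (sqrt (a n) *\<^sub>R z) < d) sequentially"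
          using d(1) by (auto simp: tendsto_iff dist_norm)
        then show "eventually (\<lambda>n. \<omega> (sqrt (a n) *\<^sub>R z) < e) sequentially"
          by eventually_elim (rule le_less_trans[OF d(2) e'(2)])
      qed simp
      then have "(\<lambda>n. ennreal (g z) * \<omega> (sqrt (a n) *\<^sub>R z)) \<longlonglongrightarrow> ennreal (g z) * 0"
        by (intro ennreal_tendsto_cmult) auto
      then show "(\<lambda>n. ennreal (g z) * \<omega> (sqrt (a n) *\<^sub>R z)) \<longlonglongrightarrow> 0" by simp
    qed
  qed (use dom fin in auto)
  then have "(\<lambda>n. \<integral>\<^sup>+z. ennreal (g z) * \<omega> (sqrt (a n) *\<^sub>R z) \<partial>lborel) \<longlonglongrightarrow> 0" by simp
  then show "(\<lambda>n. \<integral>\<^sup>+w. ennreal (norm (gauss_smooth (a n) F w - F w)) \<partial>lborel) \<longlonglongrightarrow> 0"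
    by (rule tendsto_sandwich[OF _ _ tendsto_const, rotated 2]) (auto intro!: eventuallyI bound)
  show "(\<integral>\<^sup>+w. ennreal (norm (gauss_smooth (a n) F w - F w)) \<partial>lborel) < \<infinity>"
    by (rule le_less_trans[OF bound]) (rule le_less_trans[OF nn_integral_mono[OF dom] fin])
qed

text \<open>Both inequalities come from Fatou's lemma: with \<open>T\<close> the Fourier transform of \<open>F\<close>,
  \<open>\<integral> |T|\<^sup>2 exp (- a |x|\<^sup>2)\<close> is at most \<open>(2\<pi>)\<^sup>N \<integral> |F|\<^sup>2\<close>, and it equals \<open>(2\<pi>)\<^sup>N\<close> times the squared \<open>L\<^sup>2\<close> norm of a Gaussian
  mollification of \<open>F\<close>, which tends to \<open>F\<close> almost everywhere along a subsequence.\<close>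

theorem plancherel_L1:
  fixes F :: "'a::euclidean_space \<Rightarrow> complex"
  assumes F: "integrable lborel F"
  shows "(\<integral>\<^sup>+x. ennreal ((cmod (\<integral>y. F y * iexp (x \<bullet> y) \<partial>lborel))\<^sup>2) \<partial>lborel) =
    ennreal ((2 * pi) ^ DIM('a)) * (\<integral>\<^sup>+y. ennreal ((cmod (F y))\<^sup>2) \<partial>lborel)"
proof (rule antisym)
  have Fm[measurable]: "F \<in> borel_measurable borel"
    using F by (auto dest: borel_measurable_integrable)
  define a where "a n = 1 / real (Suc n)" for n
  have a: "\<And>n. a n > 0" "a \<longlonglongrightarrow> 0"
    unfolding a_def by (auto intro: lim_1_over_n[THEN LIMSEQ_Suc, simplified])
  define T where "T x = (\<integral>y. F y * iexp (x \<bullet> y) \<partial>lborel)" for x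
  have [measurable]: "T \<in> borel_measurable borel"
  proof -
    have [measurable]: "(\<lambda>p. iexp (fst p \<bullet> (snd p :: 'a))) \<in> borel_measurable (borel \<Otimes>\<^sub>M borel)"
      unfolding borel_prod by (intro borel_measurable_continuous_onI continuous_intros)
    have "T \<in> borel_measurable lborel" unfolding T_def
      by (rule lborel.borel_measurable_lebesgue_integral) (simp add: case_prod_beta)
    then show ?thesis by simp
  qed
  \<comment> \<open>In each dimension sqrt (pi / b) * sqrt (4 pi b) = 2 pi: the parameter b cancels,
    so the bound survives the limit b -> 0.\<close>
  have A_le: "(\<integral>\<^sup>+x. ennreal ((cmod (T x))\<^sup>2 * exp (- b * (norm x)\<^sup>2)) \<partial>lborel) \<le> ennreal ((2 * pi) ^ DIM('a)) * (\<integral>\<^sup>+y. ennreal ((cmod (F y))\<^sup>2) \<partial>lborel)" if b: "b > 0" for b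
  proof -
    have "(\<integral>\<^sup>+x. ennreal ((cmod (T x))\<^sup>2 * exp (- b * (norm x)\<^sup>2)) \<partial>lborel) = ennreal (sqrt (pi / b) ^ DIM('a)) * ennreal (gauss_form b F)"
      unfolding T_def nn_integral_fourier_gauss[OF F b] using b by (simp add: ennreal_mult')
    also have "\<dots> \<le> ennreal (sqrt (pi / b) ^ DIM('a)) * (ennreal (sqrt (4 * pi * b) ^ DIM('a)) * (\<integral>\<^sup>+y. ennreal ((cmod (F y))\<^sup>2) \<partial>lborel))"
      by (intro mult_left_mono gauss_form_le F b) auto
    also have "\<dots> = ennreal (sqrt (pi / b) ^ DIM('a) * sqrt (4 * pi * b) ^ DIM('a)) * (\<integral>\<^sup>+y. ennreal ((cmod (F y))\<^sup>2) \<partial>lborel)"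
      using b by (simp add: ennreal_mult mult.assoc)
    also have "sqrt (pi / b) ^ DIM('a) * sqrt (4 * pi * b) ^ DIM('a) = (2 * pi) ^ DIM('a)"
    proof -
      have "sqrt (pi / b) * sqrt (4 * pi * b) = sqrt ((2 * pi)\<^sup>2)"
        using b by (simp add: power2_eq_square flip: real_sqrt_mult)
      also have "\<dots> = 2 * pi" by (subst real_sqrt_abs) simp
      finally show ?thesis by (simp only: power_mult_distrib[symmetric])
    qed
    finally show ?thesis .
  qed
  have "(\<integral>\<^sup>+x. ennreal ((cmod (T x))\<^sup>2) \<partial>lborel) = (\<integral>\<^sup>+x. liminf (\<lambda>n. ennreal ((cmod (T x))\<^sup>2 * exp (- a n * (norm x)\<^sup>2))) \<partial>lborel)"
  proof (intro nn_integral_cong)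
    fix x
    have "(\<lambda>n. ennreal ((cmod (T x))\<^sup>2 * exp (- a n * (norm x)\<^sup>2))) \<longlonglongrightarrow> ennreal ((cmod (T x))\<^sup>2 * exp (- 0 * (norm x)\<^sup>2))"
      by (intro tendsto_intros a)
    from lim_imp_Liminf[OF _ this] show "ennreal ((cmod (T x))\<^sup>2) = liminf (\<lambda>n. ennreal ((cmod (T x))\<^sup>2 * exp (- a n * (norm x)\<^sup>2)))"
      by simp
  qed
  also have "\<dots> \<le> liminf (\<lambda>n. \<integral>\<^sup>+x. ennreal ((cmod (T x))\<^sup>2 * exp (- a n * (norm x)\<^sup>2)) \<partial>lborel)"
    by (intro nn_integral_liminf) measurable
  also have "\<dots> \<le> liminf (\<lambda>n. ennreal ((2 * pi) ^ DIM('a)) * (\<integral>\<^sup>+y. ennreal ((cmod (F y))\<^sup>2) \<partial>lborel))"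
    by (intro Liminf_mono eventuallyI A_le a)
  also have "\<dots> = ennreal ((2 * pi) ^ DIM('a)) * (\<integral>\<^sup>+y. ennreal ((cmod (F y))\<^sup>2) \<partial>lborel)"
    by (simp add: Liminf_const)
  finally show "(\<integral>\<^sup>+x. ennreal ((cmod (T x))\<^sup>2) \<partial>lborel) \<le> \<dots>" .

  have Um: "gauss_smooth b F \<in> borel_measurable borel" if "b > 0" for b
  proof -
    have [measurable]: "(\<lambda>p. complex_of_real (exp (- (norm (fst p - snd p :: 'a))\<^sup>2 / (2 * b)))) \<in> borel_measurable (borel \<Otimes>\<^sub>M borel)"
      unfolding borel_prod using that by (intro borel_measurable_continuous_onI continuous_intros) auto
    have "gauss_smooth b F \<in> borel_measurable lborel" unfolding gauss_smooth_def
      by (intro borel_measurable_times borel_measurable_const lborel.borel_measurable_lebesgue_integral) (simp add: case_prod_beta)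
    then show ?thesis by simp
  qed
  note [measurable] = Um[OF a(1)]
  have ui: "integrable lborel (\<lambda>w. gauss_smooth (a n) F w - F w)" for n
    using gauss_smooth_tendsto_L1(2)[OF F a, of n] by (auto simp: integrable_iff_bounded)
  have "(\<lambda>n. \<integral>w. norm (gauss_smooth (a n) F w - F w) \<partial>lborel) \<longlonglongrightarrow> 0"
  proof -
    have "(\<lambda>n. enn2real (\<integral>\<^sup>+w. ennreal (norm (gauss_smooth (a n) F w - F w)) \<partial>lborel)) \<longlonglongrightarrow> 0"
      by (rule tendsto_enn2real) (simp_all add: gauss_smooth_tendsto_L1(1)[OF F a])
    then show ?thesis by (subst integral_eq_nn_integral) auto
  qed
  from tendsto_L1_AE_subseq[OF ui this] obtain r where r: "strict_mono r"
    and ae: "AE w in lborel. (\<lambda>n. gauss_smooth (a (r n)) F w - F w) \<longlonglongrightarrow> 0" by blast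
  have "(\<integral>\<^sup>+y. ennreal ((cmod (F y))\<^sup>2) \<partial>lborel) = (\<integral>\<^sup>+w. liminf (\<lambda>n. ennreal ((cmod (gauss_smooth (a (r n)) F w))\<^sup>2)) \<partial>lborel)"
  proof (rule nn_integral_cong_AE, use ae in eventually_elim)
    fix w assume "(\<lambda>n. gauss_smooth (a (r n)) F w - F w) \<longlonglongrightarrow> 0"
    then have "(\<lambda>n. gauss_smooth (a (r n)) F w) \<longlonglongrightarrow> F w" by (simp add: LIM_zero_iff)
    then have "(\<lambda>n. ennreal ((cmod (gauss_smooth (a (r n)) F w))\<^sup>2)) \<longlonglongrightarrow> ennreal ((cmod (F w))\<^sup>2)"
      by (intro tendsto_intros)
    from lim_imp_Liminf[OF _ this] show "ennreal ((cmod (F w))\<^sup>2) = liminf (\<lambda>n. ennreal ((cmod (gauss_smooth (a (r n)) F w))\<^sup>2))"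
      by simp
  qed
  also have "\<dots> \<le> liminf (\<lambda>n. \<integral>\<^sup>+w. ennreal ((cmod (gauss_smooth (a (r n)) F w))\<^sup>2) \<partial>lborel)"
    by (intro nn_integral_liminf) measurable
  also have "\<dots> \<le> liminf (\<lambda>n::nat. ennreal (1 / (2 * pi) ^ DIM('a)) * (\<integral>\<^sup>+x. ennreal ((cmod (T x))\<^sup>2) \<partial>lborel))"
  proof (intro Liminf_mono eventuallyI)
    fix n
    let ?S = "\<integral>\<^sup>+w. ennreal ((cmod (gauss_smooth (a (r n)) F w))\<^sup>2) \<partial>lborel"
    \<comment> \<open>Inserting (2 pi)^N and its inverse exposes the left side of
      \<open>gauss_smooth_square\<close>; dropping the Gaussian weight then gives a bound
      independent of n.\<close>
    have "?S = ennreal (1 / (2 * pi) ^ DIM('a)) * (ennreal ((2 * pi) ^ DIM('a)) * ?S)"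
      by (simp flip: mult.assoc ennreal_mult)
    also have "ennreal ((2 * pi) ^ DIM('a)) * ?S = (\<integral>\<^sup>+x. ennreal ((cmod (T x))\<^sup>2 * exp (- a (r n) * (norm x)\<^sup>2)) \<partial>lborel)"
      using gauss_smooth_square[OF F a(1)] by (simp add: T_def)
    also have "\<dots> \<le> (\<integral>\<^sup>+x. ennreal ((cmod (T x))\<^sup>2) \<partial>lborel)"
      using a(1)[of "r n"] by (intro nn_integral_mono ennreal_leI mult_right_le_one_le) auto
    finally show "?S \<le> ennreal (1 / (2 * pi) ^ DIM('a)) * (\<integral>\<^sup>+x. ennreal ((cmod (T x))\<^sup>2) \<partial>lborel)"
      by (simp add: mult_left_mono)
  qed
  also have "\<dots> = ennreal (1 / (2 * pi) ^ DIM('a)) * (\<integral>\<^sup>+x. ennreal ((cmod (T x))\<^sup>2) \<partial>lborel)"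
    by (simp add: Liminf_const)
  finally have "ennreal ((2 * pi) ^ DIM('a)) * (\<integral>\<^sup>+y. ennreal ((cmod (F y))\<^sup>2) \<partial>lborel) \<le>
     ennreal ((2 * pi) ^ DIM('a)) * (ennreal (1 / (2 * pi) ^ DIM('a)) * (\<integral>\<^sup>+x. ennreal ((cmod (T x))\<^sup>2) \<partial>lborel))"
    by (intro mult_left_mono) auto
  also have "\<dots> = (\<integral>\<^sup>+x. ennreal ((cmod (T x))\<^sup>2) \<partial>lborel)"
    by (simp flip: mult.assoc ennreal_mult)
  finally show "ennreal ((2 * pi) ^ DIM('a)) * (\<integral>\<^sup>+y. ennreal ((cmod (F y))\<^sup>2) \<partial>lborel) \<le> (\<integral>\<^sup>+x. ennreal ((cmod (T x))\<^sup>2) \<partial>lborel)" .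
qed

section \<open>Linear changes of variables\<close>

text \<open>Such a map preserves inner products with basis vectors, so boxes pull back to boxes with
  the same side lengths up to order. The two types may differ, which allows coordinates to be
  regrouped between nested vector and product types.\<close>

lemma lborel_distr_linear_Basis:
  fixes f :: "'a::euclidean_space \<Rightarrow> 'b::euclidean_space"
  assumes f: "linear f" and bij: "bij_betw f Basis Basis"
  shows "distr lborel borel f = lborel"
proof (rule lborel_eqI[symmetric])
  have [measurable]: "f \<in> borel_measurable borel"
    using f by (intro borel_measurable_continuous_onI linear_continuous_on) (simp add: linear_linear)
  have inn: "f x \<bullet> f b = x \<bullet> b" if b: "b \<in> Basis" for x b
  proof -
    have "f x \<bullet> f b = (\<Sum>c\<in>Basis. (x \<bullet> c) * (f c \<bullet> f b))"
      by (subst euclidean_representation[of x, symmetric])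
        (simp add: linear_sum[OF f] linear_scale[OF f] inner_sum_left)
    also have "\<dots> = (\<Sum>c\<in>Basis. (x \<bullet> c) * (if c = b then 1 else 0))"
    proof (intro sum.cong refl)
      fix c :: 'a assume c: "c \<in> Basis"
      have "f c \<in> Basis" "f b \<in> Basis" using bij b c by (auto simp: bij_betw_def)
      moreover have "f c = f b \<longleftrightarrow> c = b" using bij b c by (auto simp: bij_betw_def inj_on_def)
      ultimately show "(x \<bullet> c) * (f c \<bullet> f b) = (x \<bullet> c) * (if c = b then 1 else 0)" by (simp add: inner_Basis)
    qed
    also have "\<dots> = x \<bullet> b" using b by (simp add: if_distrib[of "(*) _"] cong: if_cong)
    finally show ?thesis .
  qed
  fix l u :: 'b assume lu: "\<And>b. b \<in> Basis \<Longrightarrow> l \<bullet> b \<le> u \<bullet> b"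
  define l' u' where "l' = (\<Sum>b\<in>Basis. (l \<bullet> f b) *\<^sub>R b)" and "u' = (\<Sum>b\<in>Basis. (u \<bullet> f b) *\<^sub>R b)"
  have l': "l' \<bullet> b = l \<bullet> f b" "u' \<bullet> b = u \<bullet> f b" if "b \<in> Basis" for b
    using that by (simp_all add: l'_def u'_def)
  have im: "Basis = f ` Basis" using bij by (simp add: bij_betw_def)
  have "f -` box l u = box l' u'"
    by (auto simp: box_def l' inn) (auto simp: im inn)
  then have "emeasure (distr lborel borel f) (box l u) = emeasure lborel (box l' u')"
    by (simp add: emeasure_distr)
  also have "\<dots> = (\<Prod>b\<in>Basis. (u' - l') \<bullet> b)"
  proof (rule emeasure_lborel_box)
    fix b :: 'a assume b: "b \<in> Basis"
    then have "f b \<in> Basis" using im by auto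
    then show "l' \<bullet> b \<le> u' \<bullet> b" using lu b by (simp add: l')
  qed
  also have "(\<Prod>b\<in>Basis. (u' - l') \<bullet> b) = (\<Prod>b\<in>Basis. (u - l) \<bullet> b)"
    by (rule prod.reindex_bij_betw[OF bij, of "\<lambda>b. (u - l) \<bullet> b", symmetric, THEN trans, symmetric])
      (auto simp: inner_diff_left l' intro!: prod.cong)
  finally show "emeasure (distr lborel borel f) (box l u) = (\<Prod>b\<in>Basis. (u - l) \<bullet> b)" .
qed simp

lemma nn_integral_linear_Basis:
  fixes f :: "'a::euclidean_space \<Rightarrow> 'b::euclidean_space"
  assumes f: "linear f" and bij: "bij_betw f Basis Basis" and h[measurable]: "h \<in> borel_measurable borel"
  shows "(\<integral>\<^sup>+x. h (f x) \<partial>lborel) = (\<integral>\<^sup>+y. h y \<partial>lborel)"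
proof -
  have [measurable]: "f \<in> borel_measurable borel"
    using f by (intro borel_measurable_continuous_onI linear_continuous_on) (simp add: linear_linear)
  show ?thesis
    by (subst lborel_distr_linear_Basis[OF f bij, symmetric]) (simp add: nn_integral_distr)
qed

text \<open>For fixed values of the other coordinates the shear is a translation of the coordinate
  along b, so integrating that coordinate innermost suffices.\<close>

lemma nn_integral_shear:
  fixes h :: "'a::euclidean_space \<Rightarrow> ennreal"
  assumes b: "b \<in> Basis" "b' \<in> Basis" "b \<noteq> b'" and h[measurable]: "h \<in> borel_measurable borel"
  shows "(\<integral>\<^sup>+x. h (x + (c * (x \<bullet> b')) *\<^sub>R b) \<partial>lborel) = (\<integral>\<^sup>+x. h x \<partial>lborel)"
proof -
  interpret product_sigma_finite "\<lambda>_::'a. lborel :: real measure" by standard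
  define I where "I = Basis - {b}"
  have I: "finite I" "b \<notin> I" "insert b I = Basis" using b by (auto simp: I_def)
  let ?e = "\<lambda>f. \<Sum>b\<in>Basis. f b *\<^sub>R b :: 'a"
  have me[measurable]: "?e \<in> Pi\<^sub>M Basis (\<lambda>_. lborel) \<rightarrow>\<^sub>M borel" by measurable
  have split: "(\<integral>\<^sup>+x. g x \<partial>lborel) = (\<integral>\<^sup>+x. \<integral>\<^sup>+y. g (?e (x(b := y))) \<partial>lborel \<partial>Pi\<^sub>M I (\<lambda>_. lborel))"
    if [measurable]: "g \<in> borel_measurable borel" for g
  proof -
    have "(\<integral>\<^sup>+x. g x \<partial>lborel) = (\<integral>\<^sup>+x. g (?e x) \<partial>Pi\<^sub>M (insert b I) (\<lambda>_. lborel))"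
      by (subst lborel_eq) (simp add: nn_integral_distr I)
    also have "\<dots> = (\<integral>\<^sup>+x. \<integral>\<^sup>+y. g (?e (x(b := y))) \<partial>lborel \<partial>Pi\<^sub>M I (\<lambda>_. lborel))"
      by (rule product_nn_integral_insert[OF I(1,2)]) (simp add: I)
    finally show ?thesis .
  qed
  have e_inner: "?e x \<bullet> b' = x b'" for x using b by simp
  have e_upd: "?e (x(b := y)) = y *\<^sub>R b + (\<Sum>b\<in>I. x b *\<^sub>R b)" for x y
  proof -
    have "?e (x(b := y)) = y *\<^sub>R b + (\<Sum>i\<in>I. (x(b := y)) i *\<^sub>R i)"
      unfolding I(3)[symmetric] using I(1,2) by simp
    also have "(\<Sum>i\<in>I. (x(b := y)) i *\<^sub>R i) = (\<Sum>b\<in>I. x b *\<^sub>R b)"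
      using I(2) by (intro sum.cong) auto
    finally show ?thesis .
  qed
  have shear: "?e (x(b := y)) + (c * (?e (x(b := y)) \<bullet> b')) *\<^sub>R b = ?e (x(b := c * x b' + y))" for x y
    unfolding e_inner unfolding e_upd using b by (simp add: scaleR_add_left)
  have "(\<integral>\<^sup>+x. h (x + (c * (x \<bullet> b')) *\<^sub>R b) \<partial>lborel) =
     (\<integral>\<^sup>+x. \<integral>\<^sup>+y. h (?e (x(b := c * x b' + y))) \<partial>lborel \<partial>Pi\<^sub>M I (\<lambda>_. lborel))"
    by (subst split) (auto simp only: shear, measurable)
  also have "\<dots> = (\<integral>\<^sup>+x. \<integral>\<^sup>+y. h (?e (x(b := y))) \<partial>lborel \<partial>Pi\<^sub>M I (\<lambda>_. lborel))"
  proof (rule nn_integral_cong)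
    fix x :: "'a \<Rightarrow> real"
    show "(\<integral>\<^sup>+y. h (?e (x(b := c * x b' + y))) \<partial>lborel) = (\<integral>\<^sup>+y. h (?e (x(b := y))) \<partial>lborel)"
      unfolding e_upd
      by (rule nn_integral_lborel_translate[of "\<lambda>y. h (y *\<^sub>R b + (\<Sum>b\<in>I. x b *\<^sub>R b))"]) measurable
  qed
  also have "\<dots> = (\<integral>\<^sup>+x. h x \<partial>lborel)" by (rule split[symmetric]) measurable
  finally show ?thesis .
qed

lemma matrix_vector_mult_measurable[measurable]: "(\<lambda>x::real^'n. A *v x) \<in> borel_measurable borel"
  by (intro borel_measurable_continuous_onI linear_continuous_on matrix_vector_mul_bounded_linear)

text \<open>The change-of-variables theorems of HOL-Analysis need a well-ordered index type, hence the
  induction over elementary matrices.\<close>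

theorem nn_integral_matrix_vector_mult:
  fixes A :: "real^'n^'n"
  assumes "det A \<noteq> 0" and "h \<in> borel_measurable borel"
  shows "ennreal \<bar>det A\<bar> * (\<integral>\<^sup>+x. h (A *v x) \<partial>lborel) = (\<integral>\<^sup>+x. h x \<partial>lborel)"
  using assms
proof (induct A arbitrary: h rule: induct_matrix_elementary[case_names mult zero_row diagonal swap1 idplus])
  case (mult A B)
  note [measurable] = mult(4)
  have d: "det A \<noteq> 0" "det B \<noteq> 0" using mult(3) by (auto simp: det_mul)
  have "ennreal \<bar>det (A ** B)\<bar> * (\<integral>\<^sup>+x. h ((A ** B) *v x) \<partial>lborel) =
     ennreal \<bar>det A\<bar> * (ennreal \<bar>det B\<bar> * (\<integral>\<^sup>+x. h (A *v (B *v x)) \<partial>lborel))"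
    by (simp add: det_mul abs_mult ennreal_mult mult.assoc matrix_vector_mul_assoc)
  also have "\<dots> = (\<integral>\<^sup>+x. h x \<partial>lborel)"
    using mult(2)[OF d(2), of "\<lambda>x. h (A *v x)"] mult(1)[OF d(1), of h] by simp
  finally show ?case .
next
  \<comment> \<open>Vacuous, as the determinant vanishes.\<close>
  case (zero_row A i)
  then show ?case by (simp add: det_zero_row)
next
  case (diagonal A)
  note [measurable] = diagonal(3)
  have dd: "det A = (\<Prod>i\<in>UNIV. A $ i $ i)" by (rule det_diagonal) (rule diagonal(1))
  then have nz: "A $ i $ i \<noteq> 0" for i using diagonal(2) by auto
  have Ax: "(A *v x) $ i = A $ i $ i * x $ i" for x i
  proof -
    have "(A *v x) $ i = (\<Sum>j\<in>UNIV. if j = i then A $ i $ i * x $ i else 0)"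
      unfolding matrix_vector_mult_def vec_lambda_beta
      by (intro sum.cong refl) (auto simp: diagonal(1))
    then show ?thesis by simp
  qed
  \<comment> \<open>Transfers the diagonal of A to a function on \<open>Basis\<close>, with value
    \<open>A $ i $ i\<close> at \<open>axis i 1\<close>, which is the form in which Lebesgue measure
    scales under coordinatewise dilations.\<close>
  define c where "c b = (\<Sum>i\<in>UNIV. A $ i $ i * b $ i)" for b :: "real^'n"
  have c: "c (axis i 1) = A $ i $ i" for i
    by (simp add: c_def axis_def if_distrib[of "(*) _"] cong: if_cong)
  have B: "(Basis :: (real^'n) set) = range (\<lambda>i. axis i 1)"
    by (auto simp: Basis_vec_def)
  have inj: "inj (\<lambda>i::'n. axis i (1::real))" by (auto simp: inj_on_def axis_eq_axis)
  have T: "(0 + (\<Sum>j\<in>Basis. (c j * (x \<bullet> j)) *\<^sub>R j)) = A *v x" for x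
    unfolding B by (subst sum.reindex[OF inj]) (simp add: vec_eq_iff Ax c inner_axis, simp add: axis_def if_distrib[of "(*) _"] cong: if_cong)
  have "lborel = density (distr lborel borel (\<lambda>x. 0 + (\<Sum>j\<in>Basis. (c j * (x \<bullet> j)) *\<^sub>R j))) (\<lambda>_. (\<Prod>j\<in>Basis. \<bar>c j\<bar>))"
    by (rule lborel_affine_euclidean) (use c nz in \<open>auto simp: B\<close>)
  also have "(\<Prod>j\<in>Basis. \<bar>c j\<bar>) = \<bar>det A\<bar>"
    unfolding B by (subst prod.reindex[OF inj]) (simp add: c dd abs_prod)
  finally have L: "lborel = density (distr lborel borel (\<lambda>x. A *v x)) (\<lambda>_. ennreal \<bar>det A\<bar>)"
    unfolding T .
  show ?case
    by (subst (2) L) (simp add: nn_integral_density nn_integral_distr nn_integral_cmult)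
next
  case (swap1 m n)
  let ?P = "(\<chi> i j. mat 1 $ i $ Transposition.transpose m n j) :: real^'n^'n"
  have d: "\<bar>det ?P\<bar> = 1" using swap1(1)
    using det_permute_columns[of "Transposition.transpose m n" "mat 1 :: real^'n^'n"]
    by (simp add: permutes_swap_id sign_swap_id)
  have Px: "?P *v x = (\<chi> i. x $ Transposition.transpose m n i)" for x
  proof -
    have "(\<Sum>j\<in>UNIV. (if i = Transposition.transpose m n j then 1 else 0) * x $ j) = (\<Sum>j\<in>UNIV. if j = Transposition.transpose m n i then x $ j else 0)" for i
      by (intro sum.cong refl) (auto simp: transpose_def)
    then show ?thesis by (simp add: vec_eq_iff matrix_vector_mult_def mat_def)
  qed
  have Pa: "?P *v axis i 1 = axis (Transposition.transpose m n i) 1" for i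
    unfolding Px by (auto simp: vec_eq_iff axis_def transpose_def)
  have "(\<integral>\<^sup>+x. h (?P *v x) \<partial>lborel) = (\<integral>\<^sup>+x. h x \<partial>lborel)"
  proof (rule nn_integral_linear_Basis)
    show "linear ((*v) ?P)" by (rule matrix_vector_mul_linear)
    show "bij_betw ((*v) ?P) Basis Basis"
    proof (rule bij_betw_byWitness[where f'="(*v) ?P"])
      show "\<forall>a\<in>Basis. ?P *v (?P *v a) = a" "\<forall>a\<in>Basis. ?P *v (?P *v a) = a"
        by (auto simp: Px)
      show "(*v) ?P ` Basis \<subseteq> Basis" "(*v) ?P ` Basis \<subseteq> Basis"
        by (auto simp: Basis_vec_def Pa)
    qed
  qed fact
  then show ?case by (simp add: d)
next
  case (idplus m n c)
  let ?P = "(\<chi> i j. if i = m \<and> j = n then c else of_bool (i = j)) :: real^'n^'n"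
  have Px: "?P *v x = x + (c * (x \<bullet> axis n 1)) *\<^sub>R axis m 1" for x
  proof -
    have "(\<Sum>j\<in>UNIV. (if i = m \<and> j = n then c else of_bool (i = j)) * x $ j) =
       (\<Sum>j\<in>UNIV. (if j = i then x $ j else 0) + (if j = n then (if i = m then c * x $ j else 0) else 0))" for i
      using idplus(1) by (intro sum.cong refl) auto
    then show ?thesis by (simp add: vec_eq_iff matrix_vector_mult_def inner_axis sum.distrib, simp add: axis_def)
  qed
  have "?P = (\<chi> k. if k = m then row m (mat 1) + c *s row n (mat 1) else row k (mat 1))"
    using idplus(1) by (auto simp: vec_eq_iff row_def mat_def)
  then have d: "det ?P = 1" using det_row_operation[OF idplus(1), of "mat 1" c] by simp
  show ?case unfolding Px d using idplus(1,3)
    by (simp add: nn_integral_shear[of "axis m 1" "axis n 1"] axis_eq_axis)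
qed

section \<open>Determinants\<close>

text \<open>Some index is sent to \<open>None\<close> by each permutation; if it is a
  \<open>Some k\<close>, the product contains a zero entry. Only permutations fixing
  \<open>None\<close> survive, and these correspond, with the same sign, to permutations of the
  smaller index type.\<close>

lemma det_option_block:
  fixes M :: "'a::comm_ring_1^'m::finite option^'m option"
  assumes z: "\<And>k. M $ Some k $ None = 0"
  shows "det M = M $ None $ None * det (\<chi> i j. M $ Some i $ Some j)"
proof -
  let ?t = "\<lambda>p. of_int (sign p) * (\<Prod>i\<in>UNIV. M $ i $ p i)"
  let ?R = "range (Some :: 'm \<Rightarrow> _)"
  have S: "inj_on Some (UNIV :: 'm set)" "bij_betw Some UNIV ?R" "bij_betw the ?R UNIV"
    by (auto simp: bij_betw_def inj_on_def image_def)
  have bij: "bij_betw (map_permutation UNIV Some) {q. q permutes (UNIV :: 'm set)} {p. p permutes ?R}"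
  proof (rule bij_betw_byWitness[where f' = "map_permutation ?R the"])
    show "\<forall>q\<in>{q. q permutes UNIV}. map_permutation ?R the (map_permutation UNIV Some q) = q"
      using S(2) by (auto intro!: map_permutation_compose_inv)
    show "\<forall>p\<in>{p. p permutes ?R}. map_permutation UNIV Some (map_permutation ?R the p) = p"
      using S(3) by (auto intro!: map_permutation_compose_inv)
  qed (use S in \<open>auto intro: map_permutation_permutes\<close>)
  have "det M = sum ?t {p. p permutes UNIV}" by (simp add: det_def)
  also have "\<dots> = sum ?t {p. p permutes ?R}"
  proof (rule sum.mono_neutral_right)
    show "\<forall>p\<in>{p. p permutes UNIV} - {p. p permutes ?R}. ?t p = 0"
    proof
      fix p assume "p \<in> {p. p permutes UNIV} - {p. p permutes ?R}"
      then have p: "p permutes UNIV" "\<not> p permutes ?R" by auto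
      have "p None \<noteq> None"
      proof
        assume "p None = None"
        then have "\<forall>x. x \<notin> ?R \<longrightarrow> p x = x" by (metis not_None_eq rangeI)
        then show False using p by (auto simp: permutes_def)
      qed
      moreover obtain i where "p i = None" using permutes_surj[OF p(1)] by (metis surjD)
      ultimately obtain k where "p (Some k) = None" by (cases i) auto
      then have "M $ Some k $ p (Some k) = 0" by (simp add: z)
      then have "(\<Prod>i\<in>UNIV. M $ i $ p i) = 0" by (metis UNIV_I finite_class.finite_UNIV prod_zero)
      then show "?t p = 0" by simp
    qed
  qed (auto intro: permutes_subset)
  also have "\<dots> = (\<Sum>q | q permutes (UNIV :: 'm set). ?t (map_permutation UNIV Some q))"
    by (rule sum.reindex_bij_betw[OF bij, symmetric])
  also have "\<dots> = (\<Sum>q | q permutes (UNIV :: 'm set). M $ None $ None * (of_int (sign q) * (\<Prod>i\<in>UNIV. M $ Some i $ Some (q i))))"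
  proof (intro sum.cong refl)
    fix q :: "'m \<Rightarrow> 'm" assume "q \<in> {q. q permutes UNIV}"
    then have q: "q permutes UNIV" by simp
    have 1: "map_permutation UNIV Some q (Some x) = Some (q x)" for x
      by (simp add: map_permutation_apply)
    have 2: "map_permutation UNIV Some q None = None"
      by (auto simp: map_permutation_def restrict_id_def)
    have "(\<Prod>i\<in>UNIV. M $ i $ map_permutation UNIV Some q i) = M $ None $ None * (\<Prod>i\<in>UNIV. M $ Some i $ Some (q i))"
      unfolding UNIV_option_conv by (subst prod.insert) (auto simp: 1 2 prod.reindex)
    then show "?t (map_permutation UNIV Some q) = M $ None $ None * (of_int (sign q) * (\<Prod>i\<in>UNIV. M $ Some i $ Some (q i)))"
      using sign_map_permutation[OF S(1) q] by (simp add: mult_ac)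
  qed
  also have "\<dots> = M $ None $ None * det (\<chi> i j. M $ Some i $ Some j)"
    by (simp add: det_def sum_distrib_left)
  finally show ?thesis .
qed

lemma det_scaleR:
  fixes A :: "real^'n^'n"
  shows "det (c *\<^sub>R A) = c ^ CARD('n) * det A"
proof -
  have "c *\<^sub>R A = (\<chi> i. c *s A $ i)" by (simp add: vec_eq_iff)
  then show ?thesis by (simp add: det_rows_mul)
qed

lemma continuous_on_det[continuous_intros]:
  fixes f :: "'b::topological_space \<Rightarrow> real^'n^'n"
  assumes "continuous_on S f"
  shows "continuous_on S (\<lambda>x. det (f x))"
  unfolding det_def by (intro continuous_intros assms)

lemma det_measurable[measurable]: "(det :: real^'n^'n \<Rightarrow> real) \<in> borel_measurable borel"
  by (intro borel_measurable_continuous_onI continuous_intros)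

text \<open>The determinant is a polynomial f in t. It is not the zero polynomial, because s^n
  f(1/s) = det (I + s A), where n is the size of the matrix, tends to 1 as s -> 0.\<close>

lemma finite_roots_det_shift:
  fixes A :: "real^'n^'n"
  shows "finite {t. det (t *\<^sub>R mat 1 + A) = 0}"
proof -
  define f where "f t = det (t *\<^sub>R mat 1 + A)" for t
  have "real_polynomial_function f"
    unfolding f_def det_def
    by (auto intro!: real_polynomial_function_sum real_polynomial_function_prod finite_permutations
          real_polynomial_function.intros(2-4) real_polynomial_function.intros(1)[OF bounded_linear_ident])
  then obtain c n where f: "f = (\<lambda>t. \<Sum>i\<le>n. c i * t ^ i)"
    by (auto simp: real_polynomial_function_iff_sum)
  have "\<exists>t. f t \<noteq> 0"
  proof (rule ccontr)
    assume "\<not> ?thesis"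
    then have z: "f t = 0" for t by simp
    let ?g = "\<lambda>s. det (mat 1 + s *\<^sub>R A)"
    have "?g s = 0" if "s \<noteq> 0" for s
    proof -
      have "mat 1 + s *\<^sub>R A = s *\<^sub>R ((1 / s) *\<^sub>R mat 1 + A)" using that by (simp add: scaleR_add_right)
      then have "?g s = s ^ CARD('n) * f (1 / s)" by (simp only: det_scaleR f_def)
      then show ?thesis by (simp add: z)
    qed
    then have "(?g \<longlongrightarrow> 0) (at 0)"
      by (intro tendsto_eventually) (auto simp: eventually_at_filter)
    moreover have "isCont ?g 0"
      using continuous_on_det[of UNIV "\<lambda>s. mat 1 + s *\<^sub>R A"] by (auto simp: continuous_on_eq_continuous_at intro!: continuous_intros)
    then have "(?g \<longlongrightarrow> ?g 0) (at 0)" by (simp add: isCont_def)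
    ultimately have "?g 0 = 0" using tendsto_unique trivial_limit_at by blast
    then show False by simp
  qed
  then have "\<exists>k\<le>n. c k \<noteq> 0" unfolding f by (metis (no_types, lifting) atMost_iff mult_zero_left sum.neutral)
  then have "finite {t. f t = 0}" unfolding f by (subst polyfun_finite_roots) auto
  then show ?thesis by (simp add: f_def)
qed

text \<open>Every line \<open>{A + t I}\<close> meets the zero set of the determinant in finitely many points.\<close>

lemma AE_det_nonzero: "AE A in lborel. det (A :: real^'n^'n) \<noteq> 0"
proof -
  define Z where "Z = {A :: real^'n^'n. det A = 0}"
  have [measurable]: "Z \<in> sets borel" unfolding Z_def by measurable
  \<comment> \<open>By translation invariance the measure of Z equals its average over the shifts by
    t I with t in [0,1]. After the integrals are exchanged, the inner one runs over finitely many
    t.\<close>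
  have "emeasure lborel Z = (\<integral>\<^sup>+t. indicator {0..1::real} t * emeasure lborel Z \<partial>lborel)"
    by (simp add: nn_integral_multc)
  also have "\<dots> = (\<integral>\<^sup>+t. \<integral>\<^sup>+A. indicator {0..1} t * indicator Z (t *\<^sub>R mat 1 + A) \<partial>lborel \<partial>lborel)"
    using nn_integral_lborel_translate[of "indicator Z"]
    by (intro nn_integral_cong) (simp add: nn_integral_cmult)
  also have "\<dots> = (\<integral>\<^sup>+A. \<integral>\<^sup>+t. indicator {0..1} t * indicator Z (t *\<^sub>R mat 1 + A) \<partial>lborel \<partial>lborel)"
    by (rule lborel_pair.Fubini'[symmetric]) measurable
  also have "\<dots> = (\<integral>\<^sup>+A. 0 \<partial>(lborel :: (real^'n^'n) measure))"
  proof (intro nn_integral_cong)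
    fix A :: "real^'n^'n"
    have "AE t in lborel. t *\<^sub>R mat 1 + A \<notin> Z"
      using finite_imp_null_set_lborel[OF finite_roots_det_shift[of A]]
      by (intro AE_I'[of "{t. det (t *\<^sub>R mat 1 + A) = 0}"]) (auto simp: Z_def)
    then show "(\<integral>\<^sup>+t. indicator {0..1} t * indicator Z (t *\<^sub>R mat 1 + A) \<partial>lborel) = 0"
      by (subst nn_integral_0_iff_AE) (auto elim!: eventually_mono)
  qed
  finally have "Z \<in> null_sets lborel" by (auto simp: null_sets_def)
  then show ?thesis by (rule AE_I'[of Z]) (auto simp: Z_def)
qed

section \<open>The phase map of the paraboloid\<close>

text \<open>Splits off the last vector, so that Fubini for a product of two Lebesgue measures
  applies.\<close>

definition join_xi :: "(real^'m) \<times> ((real^'m)^'m) \<Rightarrow> (real^'m)^'m::finite option" where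
  "join_xi p = (\<chi> j. case j of None \<Rightarrow> fst p | Some k \<Rightarrow> snd p $ k)"

text \<open>Separates the spatial parts, read as the rows of a square matrix, from the scalar parts,
  read as one vector. In this form \<open>phase\<close> leaves the matrix alone and acts on the
  vector by an affine map.\<close>

definition join_y :: "((real^'m)^'m) \<times> (real^'m) \<Rightarrow> ((real^'m) \<times> real)^'m::finite" where
  "join_y p = (\<chi> k. (fst p $ k, snd p $ k))"

lemma linear_join_xi: "linear join_xi"
  by (rule linearI) (auto simp: join_xi_def vec_eq_iff split: option.split)

lemma linear_join_y: "linear join_y"
  by (rule linearI) (auto simp: join_y_def vec_eq_iff)

lemma bij_join_xi: "bij_betw join_xi Basis (Basis :: ((real^'m)^'m::finite option) set)"
proof (rule bij_betw_byWitness[where f' = "\<lambda>\<xi>. (\<xi> $ None, \<chi> k. \<xi> $ Some k)"])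
  have 1: "join_xi (b, 0) = axis None b" "join_xi (0, axis k b) = axis (Some k) b" for b :: "real^'m" and k
    by (auto simp: join_xi_def vec_eq_iff axis_def split: option.split)
  show "join_xi ` Basis \<subseteq> (Basis :: ((real^'m)^'m option) set)"
  proof clarify
    fix a b assume "(a, b) \<in> (Basis :: ((real^'m) \<times> ((real^'m)^'m)) set)"
    then consider "a \<in> Basis" "b = 0" | k c where "a = 0" "b = axis k c" "c \<in> Basis"
      by (auto simp: Basis_prod_def Basis_vec_def)
    then show "join_xi (a, b) \<in> Basis"
      by cases (auto simp: 1 axis_in_Basis_iff)
  qed
  show "(\<lambda>\<xi>. (\<xi> $ None, \<chi> k. \<xi> $ Some k)) ` (Basis :: ((real^'m)^'m option) set) \<subseteq> Basis"
  proof clarify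
    fix \<xi> :: "(real^'m)^'m option" assume "\<xi> \<in> Basis"
    then obtain j b where \<xi>: "\<xi> = axis j b" "b \<in> Basis" by (auto simp: Basis_vec_def)
    show "(\<xi> $ None, \<chi> k. \<xi> $ Some k) \<in> Basis"
    proof (cases j)
      case None
      then have "(\<chi> k. \<xi> $ Some k) = 0" "\<xi> $ None = b" using \<xi> by (auto simp: vec_eq_iff axis_def)
      then show ?thesis using \<xi> by (simp add: Basis_prod_def)
    next
      case (Some k)
      then have "(\<chi> k. \<xi> $ Some k) = axis k b" "\<xi> $ None = 0" using \<xi> by (auto simp: vec_eq_iff axis_def)
      then show ?thesis using \<xi> by (auto simp: Basis_prod_def axis_in_Basis_iff)
    qed
  qed
qed (auto simp: join_xi_def vec_eq_iff split: option.split)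

lemma bij_join_y: "bij_betw join_y Basis (Basis :: (((real^'m) \<times> real)^'m::finite) set)"
proof (rule bij_betw_byWitness[where f' = "\<lambda>y. (\<chi> k. fst (y $ k), \<chi> k. snd (y $ k))"])
  have 1: "join_y (axis k b, 0) = axis k (b, 0)" "join_y (0, axis k (1::real)) = axis k (0, 1)" for b :: "real^'m" and k
    by (auto simp: join_y_def vec_eq_iff axis_def zero_prod_def)
  show "join_y ` Basis \<subseteq> (Basis :: (((real^'m) \<times> real)^'m) set)"
  proof clarify
    fix a b assume "(a, b) \<in> (Basis :: (((real^'m)^'m) \<times> (real^'m)) set)"
    then consider k c where "a = axis k c" "c \<in> Basis" "b = 0" | k where "a = 0" "b = axis k 1"
      by (auto simp: Basis_prod_def Basis_vec_def)
    then show "join_y (a, b) \<in> Basis"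
      by cases (auto simp: 1 axis_in_Basis_iff Basis_prod_def)
  qed
  show "(\<lambda>y. (\<chi> k. fst (y $ k), \<chi> k. snd (y $ k))) ` (Basis :: (((real^'m) \<times> real)^'m) set) \<subseteq> Basis"
  proof clarify
    fix y :: "((real^'m) \<times> real)^'m" assume "y \<in> Basis"
    then obtain k b where y: "y = axis k b" "b \<in> Basis" by (auto simp: Basis_vec_def)
    have "(\<chi> k. fst (y $ k)) = axis k (fst b)" "(\<chi> k. snd (y $ k)) = axis k (snd b)"
      using y by (auto simp: vec_eq_iff axis_def)
    then show "(\<chi> k. fst (y $ k), \<chi> k. snd (y $ k)) \<in> Basis"
      using y(2) by (auto simp: Basis_prod_def axis_in_Basis_iff)
  qed
qed (auto simp: join_y_def vec_eq_iff)

lemma borel_measurable_linear: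
  fixes f :: "'a::euclidean_space \<Rightarrow> 'b::euclidean_space"
  shows "linear f \<Longrightarrow> f \<in> borel_measurable borel"
  by (intro borel_measurable_continuous_onI linear_continuous_on) (simp add: linear_linear)

lemmas join_measurable[measurable] = borel_measurable_linear[OF linear_join_xi] borel_measurable_linear[OF linear_join_y]

definition diffs :: "(real^'m)^'m::finite option \<Rightarrow> real^'m^'m" where
  "diffs \<xi> = (\<chi> k. \<xi> $ Some k - \<xi> $ None)"

definition phase :: "(real^'m)^'m::finite option \<Rightarrow> ((real^'m) \<times> real)^'m" where
  "phase \<xi> = (\<chi> k. (\<xi> $ Some k - \<xi> $ None, (norm (\<xi> $ Some k))\<^sup>2 - (norm (\<xi> $ None))\<^sup>2))"

lemma diffs_measurable[measurable]: "diffs \<in> borel_measurable borel"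
  unfolding diffs_def by (intro borel_measurable_continuous_onI continuous_intros)

lemma phase_measurable[measurable]: "phase \<in> borel_measurable borel"
  unfolding phase_def by (intro borel_measurable_continuous_onI continuous_intros)

definition sqnorms :: "real^'m^'n \<Rightarrow> real^'n" where
  "sqnorms a = (\<chi> k. (norm (a $ k))\<^sup>2)"

lemma diffs_join_xi: "diffs (join_xi (c, (\<chi> k. c) + a)) = a"
  by (simp add: diffs_def join_xi_def vec_eq_iff)

lemma phase_join_xi: "phase (join_xi (c, (\<chi> k. c) + a)) = join_y (a, sqnorms a + (2 *\<^sub>R a) *v c)"
proof -
  have "(norm (c + a $ k))\<^sup>2 - (norm c)\<^sup>2 = (norm (a $ k))\<^sup>2 + 2 * (a $ k \<bullet> c)" for k
    by (simp add: power2_norm_eq_inner inner_add_left inner_add_right inner_commute)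
  then show ?thesis
    by (simp add: phase_def join_xi_def join_y_def sqnorms_def vec_eq_iff matrix_vector_mul_component)
qed

lemma join_xi_shift_measurable:
  "(\<lambda>p. join_xi (fst p, (\<chi> k. fst p) + snd p)) \<in> borel_measurable borel"
proof (rule borel_measurable_linear)
  have "linear (\<lambda>p :: (real^'m) \<times> ((real^'m)^'m). (fst p, (\<chi> k. fst p) + snd p))"
    by (rule linearI) (auto simp: vec_eq_iff algebra_simps)
  from linear_compose[OF this linear_join_xi]
  show "linear (\<lambda>p :: (real^'m) \<times> ((real^'m)^'m). join_xi (fst p, (\<chi> k. fst p) + snd p))"
    by (simp add: o_def)
qed

text \<open>The substitution of c + a for the remaining vectors is a translation for each fixed c.
  The common shift c is placed innermost because \<open>phase\<close> is affine in c for fixed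
  a.\<close>

lemma nn_integral_join_xi:
  fixes g :: "(real^'m)^'m::finite option \<Rightarrow> ennreal"
  assumes [measurable]: "g \<in> borel_measurable borel"
  shows "(\<integral>\<^sup>+\<xi>. g \<xi> \<partial>lborel) = (\<integral>\<^sup>+a. \<integral>\<^sup>+c. g (join_xi (c, (\<chi> k. c) + a)) \<partial>lborel \<partial>lborel)"
proof -
  have "(\<integral>\<^sup>+\<xi>. g \<xi> \<partial>lborel) = (\<integral>\<^sup>+p. g (join_xi p) \<partial>lborel)"
    by (rule nn_integral_linear_Basis[OF linear_join_xi bij_join_xi, symmetric]) simp
  also have "\<dots> = (\<integral>\<^sup>+c. \<integral>\<^sup>+u. g (join_xi (c, u)) \<partial>lborel \<partial>lborel)"
    by (subst lborel.nn_integral_fst) (simp_all add: lborel_prod)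
  also have "\<dots> = (\<integral>\<^sup>+c. \<integral>\<^sup>+a. g (join_xi (c, (\<chi> k. c) + a)) \<partial>lborel \<partial>lborel)"
    by (intro nn_integral_cong nn_integral_lborel_translate[symmetric]) measurable
  also have "\<dots> = (\<integral>\<^sup>+a. \<integral>\<^sup>+c. g (join_xi (c, (\<chi> k. c) + a)) \<partial>lborel \<partial>lborel)"
    using measurable_compose[OF join_xi_shift_measurable, of g]
    by (intro lborel_pair.Fubini'[symmetric]) (simp add: lborel_prod case_prod_beta)
  finally show ?thesis .
qed

text \<open>In the coordinates (c, a) the exceptional set is a cylinder over the null set of
  singular matrices a.\<close>

lemma AE_det_diffs_nonzero: "AE \<xi> in lborel. det (diffs (\<xi> :: (real^'m)^'m::finite option)) \<noteq> 0"
proof -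
  have "(\<integral>\<^sup>+\<xi>. indicator {\<xi> :: (real^'m)^'m option. det (diffs \<xi>) = 0} \<xi> \<partial>lborel) = (\<integral>\<^sup>+a. \<integral>\<^sup>+c. indicator {a. det a = 0} a \<partial>(lborel :: (real^'m) measure) \<partial>(lborel :: (real^'m^'m) measure))"
    by (subst nn_integral_join_xi) (auto simp: indicator_def diffs_join_xi)
  also have "\<dots> = (\<integral>\<^sup>+a. 0 \<partial>(lborel :: (real^'m^'m) measure))"
    using AE_det_nonzero by (intro nn_integral_cong_AE) (auto elim!: eventually_mono)
  finally have "emeasure lborel {\<xi> :: (real^'m)^'m option. det (diffs \<xi>) = 0} = 0"
    by (subst (asm) nn_integral_indicator) auto
  then show ?thesis by (intro AE_I[of _ _ "{\<xi>. det (diffs \<xi>) = 0}"]) auto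
qed

section \<open>Change of variables by the phase map\<close>

definition jac :: "(real^'m)^'m::finite option \<Rightarrow> real" where
  "jac \<xi> = 2 ^ CARD('m) * \<bar>det (diffs \<xi>)\<bar>"

lemma jac_measurable[measurable]: "jac \<in> borel_measurable borel"
  unfolding jac_def by measurable

text \<open>For almost every a the map sending c to \<open>sqnorms a + (2 *\<^sub>R a) *v c\<close>
  is an affine bijection with Jacobian \<open>\<bar>det (2 *\<^sub>R a)\<bar>\<close>, which is
  \<open>jac\<close>. The whole substitution is thus done in the inner integral by a matrix and a
  translation.\<close>

lemma nn_integral_phase:
  fixes h :: "((real^'m) \<times> real)^'m::finite \<Rightarrow> ennreal"
  assumes h[measurable]: "h \<in> borel_measurable borel"
  shows "(\<integral>\<^sup>+\<xi>. ennreal (jac \<xi>) * h (phase \<xi>) \<partial>lborel) = (\<integral>\<^sup>+y. h y \<partial>lborel)"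
proof -
  have [measurable]: "join_y \<in> borel_measurable (borel \<Otimes>\<^sub>M borel)"
    using borel_measurable_linear[OF linear_join_y] by (simp add: borel_prod)
  have "(\<integral>\<^sup>+\<xi>. ennreal (jac \<xi>) * h (phase \<xi>) \<partial>lborel) =
     (\<integral>\<^sup>+a. \<integral>\<^sup>+c. ennreal \<bar>det (2 *\<^sub>R a)\<bar> * h (join_y (a, sqnorms a + (2 *\<^sub>R a) *v c)) \<partial>lborel \<partial>lborel)"
    by (subst nn_integral_join_xi) (auto simp: jac_def diffs_join_xi phase_join_xi det_scaleR abs_mult)
  also have "\<dots> = (\<integral>\<^sup>+a. \<integral>\<^sup>+b. h (join_y (a, b)) \<partial>lborel \<partial>lborel)"
  proof (rule nn_integral_cong_AE, use AE_det_nonzero in eventually_elim)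
    fix a :: "real^'m^'m" assume a: "det a \<noteq> 0"
    have "(\<integral>\<^sup>+c. ennreal \<bar>det (2 *\<^sub>R a)\<bar> * h (join_y (a, sqnorms a + (2 *\<^sub>R a) *v c)) \<partial>lborel) =
      ennreal \<bar>det (2 *\<^sub>R a)\<bar> * (\<integral>\<^sup>+c. h (join_y (a, sqnorms a + (2 *\<^sub>R a) *v c)) \<partial>lborel)"
      by (rule nn_integral_cmult) measurable
    also have "\<dots> = (\<integral>\<^sup>+b. h (join_y (a, sqnorms a + b)) \<partial>lborel)"
      using a by (intro nn_integral_matrix_vector_mult) (simp_all add: det_scaleR)
    also have "\<dots> = (\<integral>\<^sup>+b. h (join_y (a, b)) \<partial>lborel)"
      by (rule nn_integral_lborel_translate) measurable
    finally show "(\<integral>\<^sup>+c. ennreal \<bar>det (2 *\<^sub>R a)\<bar> * h (join_y (a, sqnorms a + (2 *\<^sub>R a) *v c)) \<partial>lborel) = (\<integral>\<^sup>+b. h (join_y (a, b)) \<partial>lborel)" .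
  qed
  also have "\<dots> = (\<integral>\<^sup>+p. h (join_y p) \<partial>lborel)"
    by (subst lborel.nn_integral_fst) (simp_all add: lborel_prod)
  also have "\<dots> = (\<integral>\<^sup>+y. h y \<partial>lborel)"
    by (rule nn_integral_linear_Basis[OF linear_join_y bij_join_y]) simp
  finally show ?thesis .
qed

text \<open>Applying the identity to indicators turns it into an equality of measures, by which
  integrability and complex integrals can be transported too.\<close>

lemma distr_phase: "distr (density lborel (\<lambda>\<xi>. ennreal (jac \<xi>))) borel phase = lborel"
proof (rule measure_eqI)
  fix S assume "S \<in> sets (distr (density lborel (\<lambda>\<xi>. ennreal (jac \<xi>))) borel (phase :: (real^'a)^'a option \<Rightarrow> _))"
  then have [measurable]: "S \<in> sets borel" by simp
  have "emeasure (distr (density lborel (\<lambda>\<xi>. ennreal (jac \<xi>))) borel phase) S = (\<integral>\<^sup>+\<xi>. ennreal (jac \<xi>) * indicator S (phase \<xi>) \<partial>lborel)"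
    by (simp add: emeasure_distr emeasure_density indicator_vimage vimage_def indicator_def)
  also have "\<dots> = emeasure lborel S"
    by (subst nn_integral_phase) simp_all
  finally show "emeasure (distr (density lborel (\<lambda>\<xi>. ennreal (jac \<xi>))) borel phase) S = emeasure lborel S" .
qed simp

text \<open>Cramer's rule for \<open>\<xi>\<^sub>n\<close>; this inverts \<^const>\<open>phase\<close> only where \<^term>\<open>det (diffs \<xi>) \<noteq> 0\<close>.\<close>

definition unphase :: "((real^'m) \<times> real)^'m::finite \<Rightarrow> (real^'m)^'m option" where
  "unphase y = (let a = (\<chi> k. fst (y $ k)); b = (\<chi> k. snd (y $ k)) - sqnorms a;
     c = (1 / det (2 *\<^sub>R a)) *\<^sub>R (\<chi> k. det (\<chi> i j. if j = k then b $ i else (2 *\<^sub>R a) $ i $ j))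
     in join_xi (c, (\<chi> k. c) + a))"

lemma unphase_phase:
  assumes "det (diffs \<xi>) \<noteq> 0"
  shows "unphase (phase \<xi>) = \<xi>"
proof -
  define a c where "a = diffs \<xi>" and "c = \<xi> $ None"
  have \<xi>: "\<xi> = join_xi (c, (\<chi> k. c) + a)"
    by (simp add: a_def c_def diffs_def join_xi_def vec_eq_iff split: option.split)
  have d: "det (2 *\<^sub>R a) \<noteq> 0" using assms by (simp add: a_def det_scaleR)
  have y: "(\<chi> k. fst (phase \<xi> $ k)) = a" "(\<chi> k. snd (phase \<xi> $ k)) - sqnorms a = (2 *\<^sub>R a) *v c"
    unfolding \<xi> phase_join_xi by (simp_all add: join_y_def vec_eq_iff)
  have "(1 / det (2 *\<^sub>R a)) *\<^sub>R (\<chi> k. det (\<chi> i j. if j = k then ((2 *\<^sub>R a) *v c) $ i else (2 *\<^sub>R a) $ i $ j)) = c"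
    unfolding cramer_lemma using d by (simp add: vec_eq_iff)
  then show ?thesis
    unfolding unphase_def y Let_def using \<xi> by simp
qed

text \<open>This is where the explicit inverse pays off: the numerators in Cramer's rule are
  continuous in y, and the reciprocal of the determinant is Borel even where the determinant
  vanishes.\<close>

lemma unphase_measurable[measurable]: "unphase \<in> borel_measurable borel"
proof -
  have [measurable]: "(\<lambda>y :: ((real^'m) \<times> real)^'m. \<chi> k. fst (y $ k)) \<in> borel_measurable borel"
    by (intro borel_measurable_continuous_onI continuous_intros)
  have [measurable]: "(\<lambda>y :: ((real^'m) \<times> real)^'m. (\<chi> k. det (\<chi> i j. if j = k then ((\<chi> k. snd (y $ k)) - sqnorms (\<chi> k. fst (y $ k))) $ i else (2 *\<^sub>R (\<chi> k. fst (y $ k))) $ i $ j))) \<in> borel_measurable borel"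
  proof -
    have "continuous_on UNIV (\<lambda>y :: ((real^'m) \<times> real)^'m. if j = k then ((\<chi> k. snd (y $ k)) - sqnorms (\<chi> k. fst (y $ k))) $ i else (2 *\<^sub>R (\<chi> k. fst (y $ k))) $ i $ j)" for i j k
      by (cases "j = k") (auto simp: sqnorms_def intro!: continuous_intros)
    then show ?thesis by (intro borel_measurable_continuous_onI continuous_intros)
  qed
  show ?thesis
    unfolding unphase_def Let_def
    by (rule measurable_compose[OF _ join_xi_shift_measurable, where f = "\<lambda>y. (c y, a y)" for c a, unfolded fst_conv snd_conv])
      (simp only: borel_prod[symmetric], measurable)
qed

text \<open>The function \<open>F\<close> is the density of the push-forward of H under
  \<open>phase\<close>, so its Fourier transform is the oscillatory integral of H. In the integral
  of |F|^2 the substitution restores one factor \<open>jac\<close> against the two in the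
  denominator.\<close>

theorem plancherel_phase:
  fixes H :: "(real^'m)^'m::finite option \<Rightarrow> complex"
  assumes H: "integrable lborel H"
  shows "(\<integral>\<^sup>+x. ennreal ((cmod (\<integral>\<xi>. H \<xi> * iexp (x \<bullet> phase \<xi>) \<partial>lborel))\<^sup>2) \<partial>lborel) =
    ennreal ((2 * pi) ^ (CARD('m) * Suc CARD('m))) * (\<integral>\<^sup>+\<xi>. ennreal ((cmod (H \<xi>))\<^sup>2 / jac \<xi>) \<partial>lborel)"
proof -
  define F where "F y = H (unphase y) / complex_of_real (jac (unphase y))" for y
  have [measurable]: "H \<in> borel_measurable borel" using H by (auto dest: borel_measurable_integrable)
  have [measurable]: "F \<in> borel_measurable borel" unfolding F_def by measurable
  have jac0: "jac \<xi> \<ge> 0" for \<xi> :: "(real^'m)^'m option" by (simp add: jac_def)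
  have FH: "AE \<xi> in lborel. jac \<xi> > 0 \<and> F (phase \<xi>) = H \<xi> / complex_of_real (jac \<xi>)"
    using AE_det_diffs_nonzero by eventually_elim (auto simp: F_def unphase_phase jac_def)
  \<comment> \<open>Pulled back, only the values of F at points \<open>phase \<xi>\<close> count, so
    those where \<open>unphase\<close> is not an inverse are harmless. With g = 1 this gives
    integrability of F, with g a character its Fourier transform.\<close>
  have Fi: "integrable lborel (\<lambda>y. F y * g y) \<longleftrightarrow> integrable lborel (\<lambda>\<xi>. H \<xi> * g (phase \<xi>))"
    and FI: "(\<integral>y. F y * g y \<partial>lborel) = (\<integral>\<xi>. H \<xi> * g (phase \<xi>) \<partial>lborel)"
    if [measurable]: "g \<in> borel_measurable borel" for g
  proof -
    have AE: "AE \<xi> in lborel. jac \<xi> *\<^sub>R (F (phase \<xi>) * g (phase \<xi>)) = H \<xi> * g (phase \<xi>)"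
      using FH by eventually_elim (auto simp: scaleR_conv_of_real)
    have "integrable lborel (\<lambda>y. F y * g y) \<longleftrightarrow> integrable lborel (\<lambda>\<xi>. jac \<xi> *\<^sub>R (F (phase \<xi>) * g (phase \<xi>)))"
      by (subst distr_phase[symmetric]) (simp add: integrable_distr_eq integrable_density jac0)
    also have "\<dots> \<longleftrightarrow> integrable lborel (\<lambda>\<xi>. H \<xi> * g (phase \<xi>))"
      by (rule integrable_cong_AE[OF _ _ AE]) measurable
    finally show "integrable lborel (\<lambda>y. F y * g y) \<longleftrightarrow> integrable lborel (\<lambda>\<xi>. H \<xi> * g (phase \<xi>))" .
    have "(\<integral>y. F y * g y \<partial>lborel) = (\<integral>\<xi>. jac \<xi> *\<^sub>R (F (phase \<xi>) * g (phase \<xi>)) \<partial>lborel)"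
      by (subst distr_phase[symmetric]) (simp add: integral_distr integral_density jac0)
    also have "\<dots> = (\<integral>\<xi>. H \<xi> * g (phase \<xi>) \<partial>lborel)"
      by (rule integral_cong_AE[OF _ _ AE]) measurable
    finally show "(\<integral>y. F y * g y \<partial>lborel) = (\<integral>\<xi>. H \<xi> * g (phase \<xi>) \<partial>lborel)" .
  qed
  have F: "integrable lborel F" using Fi[of "\<lambda>_. 1"] H by simp
  have m: "(\<lambda>y. iexp (x \<bullet> y)) \<in> borel_measurable borel" for x :: "((real^'m) \<times> real)^'m"
    by (intro borel_measurable_continuous_onI continuous_intros)
  have dim: "DIM(((real^'m) \<times> real)^'m) = CARD('m) * Suc CARD('m)" by simp
  have "(\<integral>\<^sup>+y. ennreal ((cmod (F y))\<^sup>2) \<partial>lborel) = (\<integral>\<^sup>+\<xi>. ennreal (jac \<xi>) * ennreal ((cmod (F (phase \<xi>)))\<^sup>2) \<partial>lborel)"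
    by (rule nn_integral_phase[symmetric]) measurable
  also have "\<dots> = (\<integral>\<^sup>+\<xi>. ennreal ((cmod (H \<xi>))\<^sup>2 / jac \<xi>) \<partial>lborel)"
    using FH by (intro nn_integral_cong_AE, eventually_elim)
      (auto simp: norm_divide power_divide power2_eq_square simp flip: ennreal_mult)
  finally show ?thesis
    using plancherel_L1[OF F] unfolding FI[OF m] dim by simp
qed

section \<open>Reduction of the operator to the phase map\<close>

text \<open>Subtract the column of index \<^const>\<open>None\<close> from the others.\<close>

lemma det_bordered: "det (bordered v) = det (diffs v)"
proof -
  \<comment> \<open>The rows of \<open>transpose (bordered v)\<close> are (1, v_j). The rows of
    \<open>E\<close> are (1, v_n) and (0, v_l - v_n), and \<open>L\<close> adds the row
    \<open>None\<close> back to every other one. Both \<open>E\<close> and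
    \<open>transpose L\<close> have zeros in column \<open>None\<close> off the top row, as
    \<open>det_option_block\<close> requires.\<close>
  define L :: "real^'a option^'a option" where "L = (\<chi> j i. if i = None \<or> i = j then 1 else 0)"
  define E :: "real^'a option^'a option" where
    "E = (\<chi> j i. case i of None \<Rightarrow> (case j of None \<Rightarrow> 1 | Some l \<Rightarrow> 0)
                 | Some k \<Rightarrow> (case j of None \<Rightarrow> v $ None $ k | Some l \<Rightarrow> diffs v $ l $ k))"
  have "transpose (bordered v) = L ** E"
  proof (unfold vec_eq_iff, intro allI)
    fix j i
    have s: "(L ** E) $ j $ i = L $ j $ None * E $ None $ i + (\<Sum>l\<in>UNIV. L $ j $ Some l * E $ Some l $ i)"
      unfolding matrix_matrix_mult_def UNIV_option_conv by (simp add: sum.reindex)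
    show "transpose (bordered v) $ j $ i = (L ** E) $ j $ i"
      unfolding s
      by (cases j; cases i) (auto simp: transpose_def bordered_def L_def E_def diffs_def if_distrib[of "\<lambda>x. x * _"] cong: if_cong)
  qed
  then have "det (bordered v) = det (transpose L) * det E"
    by (metis det_mul det_transpose)
  also have "det (transpose L) = 1"
  proof -
    have "(\<chi> i j. transpose L $ Some i $ Some j) = (mat 1 :: real^'a^'a)"
      by (auto simp: vec_eq_iff transpose_def L_def mat_def)
    then show ?thesis by (subst det_option_block) (auto simp: transpose_def L_def)
  qed
  also have "det E = det (diffs v)"
  proof -
    have "(\<chi> i j. E $ Some i $ Some j) = diffs v" by (simp add: vec_eq_iff E_def)
    then show ?thesis by (subst det_option_block) (auto simp: E_def)
  qed
  finally show ?thesis by simp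
qed

lemma grad_paraboloid: "grad paraboloid \<xi> = 2 *\<^sub>R \<xi>"
proof -
  have "GDERIV (\<lambda>x. x \<bullet> x) \<xi> :> 2 *\<^sub>R \<xi>"
    unfolding gderiv_def by (auto intro!: derivative_eq_intros simp: inner_commute)
  then have "GDERIV paraboloid \<xi> :> 2 *\<^sub>R \<xi>"
    by (simp add: paraboloid_def[abs_def] power2_norm_eq_inner)
  \<comment> \<open>\<open>grad\<close> is a definite description, so uniqueness of the gradient is
    part of computing it.\<close>
  moreover have "D = 2 *\<^sub>R \<xi>" if "GDERIV paraboloid \<xi> :> D" for D
  proof -
    have "(\<lambda>h. h \<bullet> D) = (\<lambda>h. h \<bullet> (2 *\<^sub>R \<xi>))"
      using that calculation unfolding gderiv_def by (rule has_derivative_unique)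
    then show ?thesis by (metis inner_commute vector_eq_ldot)
  qed
  ultimately show ?thesis unfolding grad_def by (rule the_equality)
qed

text \<open>The factor 2 in the gradient scales the (n-1) x (n-1) matrix of differences, producing
  the same 2^(n-1) as the Jacobian of \<open>phase\<close>. Weight and Jacobian can therefore be
  merged into a single power.\<close>

lemma det_weight_paraboloid: "det_weight (\<lambda>j. paraboloid) \<sigma> \<xi> = rpow (jac \<xi>) \<sigma>"
proof -
  have "diffs (\<chi> j. 2 *\<^sub>R \<xi> $ j) = 2 *\<^sub>R diffs \<xi>"
    by (simp add: diffs_def vec_eq_iff right_diff_distrib)
  then show ?thesis
    by (simp add: det_weight_def grad_paraboloid det_bordered det_scaleR jac_def abs_mult)
qed

lemma sum_zero_point_phase:
  "(\<Sum>j\<in>UNIV. fst (sum_zero_point x $ j) \<bullet> \<xi> $ j + snd (sum_zero_point x $ j) * paraboloid (\<xi> $ j)) = x \<bullet> phase \<xi>"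
proof -
  have "(\<Sum>j\<in>UNIV. fst (sum_zero_point x $ j) \<bullet> \<xi> $ j + snd (sum_zero_point x $ j) * paraboloid (\<xi> $ j)) =
    fst (- (\<Sum>k\<in>UNIV. x $ k)) \<bullet> \<xi> $ None + snd (- (\<Sum>k\<in>UNIV. x $ k)) * paraboloid (\<xi> $ None)
    + (\<Sum>k\<in>UNIV. fst (x $ k) \<bullet> \<xi> $ Some k + snd (x $ k) * paraboloid (\<xi> $ Some k))"
    unfolding UNIV_option_conv by (simp add: sum.reindex sum_zero_point_def)
  also have "\<dots> = (\<Sum>k\<in>UNIV. x $ k \<bullet> phase \<xi> $ k)"
    by (simp add: fst_sum snd_sum inner_sum_left sum_distrib_right sum_negf sum.distrib sum_subtractf
      inner_prod_def phase_def paraboloid_def inner_diff_right right_diff_distrib)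
  also have "\<dots> = x \<bullet> phase \<xi>"
    by (simp only: inner_vec_def)
  finally show ?thesis .
qed

lemma T_op_paraboloid:
  "T_op (\<lambda>j. paraboloid) \<sigma> g (sum_zero_point x) =
    (LINT \<xi>|lebesgue. (complex_of_real (rpow (jac \<xi>) \<sigma>) * (\<Prod>j\<in>UNIV. g j (\<xi> $ j))) * iexp (x \<bullet> phase \<xi>))"
proof -
  have "(\<Prod>j\<in>UNIV. iexp (r j) * c j) = (\<Prod>j\<in>UNIV. c j) * iexp (\<Sum>j\<in>UNIV. r j)" for r :: "'a option \<Rightarrow> real" and c
    by (simp add: prod.distrib exp_sum sum_distrib_left)
  then show ?thesis
    unfolding T_op_def det_weight_paraboloid by (simp only: sum_zero_point_phase mult.assoc)
qed

section \<open>From Lebesgue to Borel measurable functions, and the identity\<close>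

text \<open>The functions g_j are only Lebesgue measurable, whereas compositions with
  \<open>phase\<close> and \<open>unphase\<close> are handled for Borel functions. A Borel
  representative is taken for the real and imaginary parts separately.\<close>

lemma lebesgue_integrable_AE_lborel:
  fixes f :: "'a::euclidean_space \<Rightarrow> complex"
  assumes f: "integrable lebesgue f"
  obtains f' where "integrable lborel f'" "AE x in lborel. f x = f' x"
proof -
  have "(\<lambda>x. Re (f x)) \<in> borel_measurable lebesgue" "(\<lambda>x. Im (f x)) \<in> borel_measurable lebesgue"
    using borel_measurable_integrable[OF f] by measurable
  then obtain u v where [measurable]: "u \<in> borel_measurable lborel" "v \<in> borel_measurable lborel"
    and uv: "AE x in lborel. Re (f x) = u x" "AE x in lborel. Im (f x) = v x"
    using completion_ex_borel_measurable_real by metis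
  have m: "(\<lambda>x. Complex (u x) (v x)) \<in> borel_measurable lborel"
    unfolding Complex_eq by measurable
  have ae: "AE x in lborel. f x = Complex (u x) (v x)"
    using uv by eventually_elim (simp add: complex_eq_iff)
  have "integrable lebesgue (\<lambda>x. Complex (u x) (v x))"
    by (rule integrable_cong_AE_imp[OF f measurable_completion[OF m] AE_completion[OF ae]])
  then have "integrable lborel (\<lambda>x. Complex (u x) (v x))"
    using m by (simp add: integrable_completion)
  then show thesis using ae that by blast
qed

text \<open>With D the absolute value of \<open>det (bordered \<xi>)\<close> one has jac = 2^(n-1)
  D, so the power -(1 - 2 \<sigma>) of \<open>jac\<close> yields both the denominator and the power
  of 2. The constant is 2^(-(n-1)) from the Jacobian times 2^(2 (n-1) \<sigma>) from the gradient 2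
  \<xi> in the weight; the latter factor is 1 only for \<sigma> = 0. Both sides may be
  infinite.\<close>

theorem theorem1p4:
  fixes n :: nat and \<sigma> :: real
    and g :: "'m::finite option \<Rightarrow> real^'m \<Rightarrow> complex"
  assumes "2 \<le> n" and "CARD('m) = n - 1"
    and "\<And>j. integrable lebesgue (g j)"
    and "T_defined (\<lambda>j. paraboloid) \<sigma> g"
    and "\<sigma> < 0 \<Longrightarrow> \<forall>\<xi>. (\<forall>j. \<xi> $ j \<in> supp (g j)) \<longrightarrow> det (bordered \<xi>) \<noteq> 0"
  shows "(\<integral>\<^sup>+ x. ennreal ((cmod (T_op (\<lambda>j. paraboloid) \<sigma> g (sum_zero_point x)))\<^sup>2) \<partial>lebesgue) =
    ennreal (2 powr (- (real n - 1) * (1 - 2 * \<sigma>)) * (2 * pi) ^ (n * (n - 1))) *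
    (\<integral>\<^sup>+ \<xi>. ennreal ((\<Prod>j\<in>UNIV. (cmod (g j (\<xi> $ j)))\<^sup>2)
                     / rpow \<bar>det (bordered \<xi>)\<bar> (1 - 2 * \<sigma>)) \<partial>lebesgue)"
proof -
  define G where "G \<xi> = (\<Prod>j\<in>UNIV. g j (\<xi> $ j))" for \<xi>
  define H where "H \<xi> = complex_of_real (rpow (jac \<xi>) \<sigma>) * G \<xi>" for \<xi>
  let ?R = "\<lambda>\<xi>. (\<Prod>j\<in>UNIV. (cmod (g j (\<xi> $ j)))\<^sup>2) / rpow \<bar>det (bordered \<xi>)\<bar> (1 - 2 * \<sigma>)"
  let ?c = "2 powr (- (real n - 1) * (1 - 2 * \<sigma>))"
  have Hi: "integrable lebesgue H"
    using assms(4) by (simp add: T_defined_def det_weight_paraboloid H_def[abs_def] G_def)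
  then obtain H' where H': "integrable lborel H'" and ae: "AE \<xi> in lborel. H \<xi> = H' \<xi>"
    by (rule lebesgue_integrable_AE_lborel)
  note Hm = borel_measurable_integrable[OF Hi]
  have [measurable]: "H' \<in> borel_measurable lborel" using H' by simp
  have T: "T_op (\<lambda>j. paraboloid) \<sigma> g (sum_zero_point x) = (\<integral>\<xi>. H' \<xi> * iexp (x \<bullet> phase \<xi>) \<partial>lborel)" for x
  proof -
    have e[measurable]: "(\<lambda>\<xi>. iexp (x \<bullet> phase \<xi>)) \<in> borel_measurable lborel"
      by measurable
    have "T_op (\<lambda>j. paraboloid) \<sigma> g (sum_zero_point x) = (\<integral>\<xi>. H \<xi> * iexp (x \<bullet> phase \<xi>) \<partial>lebesgue)"
      by (simp add: T_op_paraboloid H_def G_def)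
    also have "\<dots> = (\<integral>\<xi>. H' \<xi> * iexp (x \<bullet> phase \<xi>) \<partial>lebesgue)"
    proof (rule integral_cong_AE)
      show "(\<lambda>\<xi>. H \<xi> * iexp (x \<bullet> phase \<xi>)) \<in> borel_measurable lebesgue"
        by (intro borel_measurable_times Hm measurable_completion e)
      show "(\<lambda>\<xi>. H' \<xi> * iexp (x \<bullet> phase \<xi>)) \<in> borel_measurable lebesgue"
        by (intro measurable_completion) measurable
      show "AE \<xi> in lebesgue. H \<xi> * iexp (x \<bullet> phase \<xi>) = H' \<xi> * iexp (x \<bullet> phase \<xi>)"
        using AE_completion[OF ae] by eventually_elim simp
    qed
    also have "\<dots> = (\<integral>\<xi>. H' \<xi> * iexp (x \<bullet> phase \<xi>) \<partial>lborel)"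
      by (rule integral_completion) measurable
    finally show ?thesis .
  qed
  \<comment> \<open>Discarding the null set of vanishing determinants makes every base positive, so
    \<open>rpow\<close> is \<open>powr\<close> throughout and no division by zero enters.\<close>
  have R: "AE \<xi> in lborel. (cmod (H' \<xi>))\<^sup>2 / jac \<xi> = ?c * ?R \<xi>"
  using ae AE_det_diffs_nonzero
  proof eventually_elim
    fix \<xi> :: "(real^'m)^'m option" assume \<xi>: "H \<xi> = H' \<xi>" "det (diffs \<xi>) \<noteq> 0"
    define D where "D = \<bar>det (diffs \<xi>)\<bar>"
    have D: "D > 0" "\<bar>det (bordered \<xi>)\<bar> = D" "jac \<xi> = 2 ^ CARD('m) * D"
      using \<xi> by (auto simp: D_def det_bordered jac_def)
    have j0: "jac \<xi> > 0" using D by simp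
    have r: "rpow a s = a powr s" if "a > 0" for a s using that by (simp add: rpow_def)
    have "(cmod (H' \<xi>))\<^sup>2 / jac \<xi> = (cmod (G \<xi>))\<^sup>2 * ((jac \<xi> powr \<sigma>)\<^sup>2 / jac \<xi>)"
      using j0 unfolding \<xi>(1)[symmetric] by (simp add: H_def r norm_mult power_mult_distrib)
    also have "(jac \<xi> powr \<sigma>)\<^sup>2 / jac \<xi> = jac \<xi> powr (- (1 - 2 * \<sigma>))"
      using j0 by (simp add: power2_eq_square powr_diff flip: powr_add)
    also have "\<dots> = (2 ^ CARD('m)) powr (- (1 - 2 * \<sigma>)) * D powr (- (1 - 2 * \<sigma>))"
      unfolding D(3) by (rule powr_mult)
    also have "(2 ^ CARD('m) :: real) powr (- (1 - 2 * \<sigma>)) = ?c"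
      using assms(1,2) by (simp add: powr_powr of_nat_diff algebra_simps flip: powr_realpow)
    also have "(cmod (G \<xi>))\<^sup>2 * (?c * D powr (- (1 - 2 * \<sigma>))) = ?c * ((\<Prod>j\<in>UNIV. (cmod (g j (\<xi> $ j)))\<^sup>2) / rpow D (1 - 2 * \<sigma>))"
      using D(1) by (simp only: r powr_minus_divide) (simp add: G_def prod_norm[symmetric] prod_power_distrib)
    finally show "(cmod (H' \<xi>))\<^sup>2 / jac \<xi> = ?c * ?R \<xi>"
      unfolding D(2) .
  qed
  have n: "CARD('m) * Suc CARD('m) = n * (n - 1)" using assms(1,2) by simp
  have "(\<integral>\<^sup>+ x. ennreal ((cmod (T_op (\<lambda>j. paraboloid) \<sigma> g (sum_zero_point x)))\<^sup>2) \<partial>lebesgue) =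
    ennreal ((2 * pi) ^ (n * (n - 1))) * (\<integral>\<^sup>+\<xi>. ennreal ((cmod (H' \<xi>))\<^sup>2 / jac \<xi>) \<partial>lborel)"
    unfolding T nn_integral_completion plancherel_phase[OF H'] n ..
  also have "(\<integral>\<^sup>+\<xi>. ennreal ((cmod (H' \<xi>))\<^sup>2 / jac \<xi>) \<partial>lborel) = ennreal ?c * (\<integral>\<^sup>+\<xi>. ennreal (?R \<xi>) \<partial>lebesgue)"
  proof -
    \<comment> \<open>The integrand \<open>?R\<close> need not be Borel measurable, so the constant
      is pulled out, as its reciprocal, on the side of the Borel representative
      \<open>H'\<close>.\<close>
    have "(\<integral>\<^sup>+\<xi>. ennreal (?R \<xi>) \<partial>lebesgue) = (\<integral>\<^sup>+\<xi>. ennreal (1 / ?c) * ennreal ((cmod (H' \<xi>))\<^sup>2 / jac \<xi>) \<partial>lborel)"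
      unfolding nn_integral_completion
      using R by (intro nn_integral_cong_AE, eventually_elim) (simp flip: ennreal_mult')
    also have "\<dots> = ennreal (1 / ?c) * (\<integral>\<^sup>+\<xi>. ennreal ((cmod (H' \<xi>))\<^sup>2 / jac \<xi>) \<partial>lborel)"
      by (rule nn_integral_cmult) measurable
    finally show ?thesis by (simp flip: mult.assoc ennreal_mult)
  qed
  finally show ?thesis
    by (simp add: ennreal_mult' mult_ac)
qed

end
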